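(* Let $\xi$ be a recurrent non-periodic bi-infinite word, let $f_\xi\colon\mathbb N\to F(\xi)$ be a surjection, and let $\mathbf a$ be a Turing-degree above the Turing-degree of $f_\xi$. Then there exists a bi-infinite word $\xi_A$ with $\mathsf{MTh}(\xi_A)=\mathsf{MTh}(\xi)$ such that $\xi_A(-\infty,-1]\oplus f_\xi\equiv_T \xi_A[0,\infty)\oplus f_\xi\in\mathbf a$.
   Context: A bi-infinite word is a map $\xi\colon\mathbb Z\to\{0,1\}$, viewed as the structure $(\mathbb Z,\le,\xi^{-1}(1))$; $\mathsf{MTh}(\xi)$ is the set of monadic second-order sentences over $\{\le,P\}$ true in it. $F(\xi)$ is the set of factors $\xi(i)\cdots\xi(j)$ ($i\le j$) plus the empty word; $\xi$ is recurrent if $F(\xi)=F(\xi(-\infty,i])=F(\xi[i,\infty))$ for all $i\in\mathbb Z$; $\xi$ is periodic if there is $p>0$ with $\xi(n)=\xi(n+p)$ for all $n\in\mathbb Z$. $\xi[0,\infty)$ is identified with the set $\{i\ge0\mid\xi(i)=1\}$ and $\xi(-\infty,-1]$ with $\{i>0\mid\xi(-i)=1\}$. Finite words are identified with natural numbers via a fixed effective enumeration, and $f_\xi$ with the relation $\{(n,f_\xi(n))\}$ coded as a subset of $\mathbb N$. $A\oplus B=\{2a\mid a\in A\}\cup\{2b+1\mid b\in B\}$; $\equiv_T$ is Turing equivalence and "above" refers to the order induced by Turing reducibility $\le_T$. *)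

theory Defs
  imports Main "HOL-Library.Nat_Bijection"
begin

section \<open>Bi-infinite words\<close>

text \<open>The letters 0 and 1 are \<^const>\<open>False\<close> and \<^const>\<open>True\<close>.\<close>

type_synonym biword = "int \<Rightarrow> bool"

text \<open>Factors of the restriction of \<open>\<xi>\<close> to an interval \<open>I\<close> of the integers.\<close>

definition factors_on :: "biword \<Rightarrow> int set \<Rightarrow> bool list set" where
  "factors_on \<xi> I = insert [] {map \<xi> [i..j] | i j. i \<le> j \<and> {i..j} \<subseteq> I}"

abbreviation factors :: "biword \<Rightarrow> bool list set" where
  "factors \<xi> \<equiv> factors_on \<xi> UNIV"

definition recurrent :: "biword \<Rightarrow> bool" where
  "recurrent \<xi> \<longleftrightarrow>
     (\<forall>i. factors \<xi> = factors_on \<xi> {..i} \<and> factors_on \<xi> {..i} = factors_on \<xi> {i..})"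

definition periodic :: "biword \<Rightarrow> bool" where
  "periodic \<xi> \<longleftrightarrow> (\<exists>p>0. \<forall>n. \<xi> n = \<xi> (n + p))"

definition right_half :: "biword \<Rightarrow> nat set" where
  "right_half \<xi> = {i. \<xi> (int i)}"

definition left_half :: "biword \<Rightarrow> nat set" where
  "left_half \<xi> = {i. i > 0 \<and> \<xi> (- int i)}"


section \<open>Monadic second-order logic over one binary and one unary relation\<close>

text \<open>Element variables and set variables are drawn from two separate copies of the
  naturals. The remaining connectives and quantifiers are definable.\<close>

datatype mso =
    Equal nat nat
  | Leq nat nat
  | Pred nat
  | Member nat nat
  | Neg mso
  | Conj mso mso
  | ExElem nat mso
  | ExSet nat mso

fun free_elem :: "mso \<Rightarrow> nat set" where
  "free_elem (Equal x y) = {x, y}"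
| "free_elem (Leq x y) = {x, y}"
| "free_elem (Pred x) = {x}"
| "free_elem (Member x X) = {x}"
| "free_elem (Neg \<phi>) = free_elem \<phi>"
| "free_elem (Conj \<phi> \<psi>) = free_elem \<phi> \<union> free_elem \<psi>"
| "free_elem (ExElem x \<phi>) = free_elem \<phi> - {x}"
| "free_elem (ExSet X \<phi>) = free_elem \<phi>"

fun free_set :: "mso \<Rightarrow> nat set" where
  "free_set (Equal x y) = {}"
| "free_set (Leq x y) = {}"
| "free_set (Pred x) = {}"
| "free_set (Member x X) = {X}"
| "free_set (Neg \<phi>) = free_set \<phi>"
| "free_set (Conj \<phi> \<psi>) = free_set \<phi> \<union> free_set \<psi>"
| "free_set (ExElem x \<phi>) = free_set \<phi>"
| "free_set (ExSet X \<phi>) = free_set \<phi> - {X}"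

definition sentence :: "mso \<Rightarrow> bool" where
  "sentence \<phi> \<longleftrightarrow> free_elem \<phi> = {} \<and> free_set \<phi> = {}"

text \<open>Satisfaction in the structure whose universe is the whole type, with relations
  \<open>le\<close> and \<open>P\<close>; \<open>e\<close> and \<open>E\<close> assign values to element and set variables.\<close>

fun sat :: "('a \<Rightarrow> 'a \<Rightarrow> bool) \<Rightarrow> 'a set \<Rightarrow> (nat \<Rightarrow> 'a) \<Rightarrow> (nat \<Rightarrow> 'a set) \<Rightarrow> mso \<Rightarrow> bool" where
  "sat le P e E (Equal x y) \<longleftrightarrow> e x = e y"
| "sat le P e E (Leq x y) \<longleftrightarrow> le (e x) (e y)"
| "sat le P e E (Pred x) \<longleftrightarrow> e x \<in> P"
| "sat le P e E (Member x X) \<longleftrightarrow> e x \<in> E X"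
| "sat le P e E (Neg \<phi>) \<longleftrightarrow> \<not> sat le P e E \<phi>"
| "sat le P e E (Conj \<phi> \<psi>) \<longleftrightarrow> sat le P e E \<phi> \<and> sat le P e E \<psi>"
| "sat le P e E (ExElem x \<phi>) \<longleftrightarrow> (\<exists>a. sat le P (e(x := a)) E \<phi>)"
| "sat le P e E (ExSet X \<phi>) \<longleftrightarrow> (\<exists>A. sat le P e (E(X := A)) \<phi>)"

definition MTh :: "biword \<Rightarrow> mso set" where
  "MTh \<xi> = {\<phi>. sentence \<phi> \<and> (\<forall>e E. sat (\<le>) (\<xi> -` {True}) e E \<phi>)}"


section \<open>Relative computability\<close>

text \<open>Kleene's \<open>\<mu>\<close>-recursive schemes, extended by queries to a set \<open>B\<close>.
  Programs carry no arity; applied to an argument list of unsuitable length they diverge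
  or ignore the surplus arguments.\<close>

datatype prog =
    PZero
  | PSucc
  | PProj nat
  | PQuery
  | PComp prog "prog list"
  | PRec prog prog
  | PMin prog

inductive computes :: "nat set \<Rightarrow> prog \<Rightarrow> nat list \<Rightarrow> nat \<Rightarrow> bool" for B :: "nat set" where
  zero: "computes B PZero xs 0"
| succ: "computes B PSucc [x] (Suc x)"
| proj: "i < length xs \<Longrightarrow> computes B (PProj i) xs (xs ! i)"
| query: "computes B PQuery [x] (of_bool (x \<in> B))"
| comp: "list_all2 (\<lambda>q y. computes B q xs y) qs ys \<Longrightarrow> computes B p ys z \<Longrightarrow>
    computes B (PComp p qs) xs z"
| rec_0: "computes B p xs y \<Longrightarrow> computes B (PRec p q) (0 # xs) y"
| rec_Suc: "computes B (PRec p q) (n # xs) y \<Longrightarrow> computes B q (n # y # xs) z \<Longrightarrow>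
    computes B (PRec p q) (Suc n # xs) z"
| min: "computes B p (n # xs) 0 \<Longrightarrow> (\<And>m. m < n \<Longrightarrow> \<exists>y>0. computes B p (m # xs) y) \<Longrightarrow>
    computes B (PMin p) xs n"

inductive_cases computes_PZeroE: "computes B PZero xs y"
inductive_cases computes_PSuccE: "computes B PSucc xs y"
inductive_cases computes_PProjE: "computes B (PProj i) xs y"
inductive_cases computes_PQueryE: "computes B PQuery xs y"
inductive_cases computes_PCompE: "computes B (PComp p qs) xs y"
inductive_cases computes_PRecE: "computes B (PRec p q) xs y"
inductive_cases computes_PRec0E: "computes B (PRec p q) (0 # xs) y"
inductive_cases computes_PRecSucE: "computes B (PRec p q) (Suc n # xs) y"
inductive_cases computes_PMinE: "computes B (PMin p) xs y"

definition turing_le :: "nat set \<Rightarrow> nat set \<Rightarrow> bool"  (infix "\<le>\<^sub>T" 50) where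
  "A \<le>\<^sub>T B \<longleftrightarrow> (\<exists>p. \<forall>n. computes B p [n] (of_bool (n \<in> A)))"

definition turing_eq :: "nat set \<Rightarrow> nat set \<Rightarrow> bool"  (infix "\<equiv>\<^sub>T" 50) where
  "A \<equiv>\<^sub>T B \<longleftrightarrow> A \<le>\<^sub>T B \<and> B \<le>\<^sub>T A"

lemma computes_deterministic:
  "computes B p xs y \<Longrightarrow> computes B p xs z \<Longrightarrow> y = z"
proof (induction arbitrary: z rule: computes.induct)
  case (comp xs qs ys p y)
  from comp.prems obtain ys' where ys': "list_all2 (\<lambda>q y. computes B q xs y) qs ys'"
    and z: "computes B p ys' z"
    by (rule computes_PCompE)
  have "ys = ys'"
    using comp.hyps comp.IH ys' by (auto simp: list_all2_conv_all_nth intro!: nth_equalityI)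
  with z comp.IH show ?case by blast
next
  case (rec_0 p xs y q)
  from rec_0.prems rec_0.IH show ?case by (auto elim: computes_PRec0E)
next
  case (rec_Suc p q n xs y z')
  from rec_Suc.prems obtain w where "computes B (PRec p q) (n # xs) w" "computes B q (n # w # xs) z"
    by (rule computes_PRecSucE)
  with rec_Suc.IH show ?case by blast
next
  case (min p n xs)
  from min.prems have z: "computes B p (z # xs) 0" "\<And>m. m < z \<Longrightarrow> \<exists>y>0. computes B p (m # xs) y"
    by (auto elim: computes_PMinE)
  show ?case
  proof (rule linorder_cases[of n z])
    assume "n < z"
    then show ?thesis using min.IH z by blast
  next
    assume "z < n"
    then show ?thesis using min.IH z by blast
  qed
qed (auto elim: computes_PZeroE computes_PSuccE computes_PProjE computes_PQueryE)

lemma turing_le_refl: "A \<le>\<^sub>T A"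
  unfolding turing_le_def using computes.query by blast

lemma turing_le_trans:
  assumes "A \<le>\<^sub>T B" and "B \<le>\<^sub>T C"
  shows "A \<le>\<^sub>T C"
proof -
  from \<open>B \<le>\<^sub>T C\<close> obtain q where q: "\<And>n. computes C q [n] (of_bool (n \<in> B))"
    unfolding turing_le_def by blast
  have "\<exists>p'. \<forall>xs y. computes B p xs y \<longrightarrow> computes C p' xs y" for p
  proof (induction p)
    case (PComp p ps)
    then obtain p' where p': "\<And>xs y. computes B p xs y \<Longrightarrow> computes C p' xs y" by blast
    from PComp.IH(2) obtain t
      where t: "\<And>r xs y. r \<in> set ps \<Longrightarrow> computes B r xs y \<Longrightarrow> computes C (t r) xs y"
      by metis
    have "computes C (PComp p' (map t ps)) xs y" if "computes B (PComp p ps) xs y" for xs y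
    proof -
      from that obtain ys where "list_all2 (\<lambda>q y. computes B q xs y) ps ys" "computes B p ys y"
        by (rule computes_PCompE)
      then show ?thesis
        by (intro computes.comp[of C xs _ ys]) (auto simp: list_all2_conv_all_nth intro!: t p')
    qed
    then show ?case by blast
  next
    case (PRec p r)
    then obtain p' r' where IH: "\<And>xs y. computes B p xs y \<Longrightarrow> computes C p' xs y"
      "\<And>xs y. computes B r xs y \<Longrightarrow> computes C r' xs y" by metis
    have "computes C (PRec p' r') (n # xs) y" if "computes B (PRec p r) (n # xs) y" for n xs y
      using that
    proof (induction n arbitrary: y)
      case 0
      then show ?case by (auto elim!: computes_PRec0E intro: computes.rec_0 IH)
    next
      case (Suc n)
      from Suc.prems obtain w where
        "computes B (PRec p r) (n # xs) w" "computes B r (n # w # xs) y"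
        by (rule computes_PRecSucE)
      then show ?case by (blast intro: computes.rec_Suc Suc.IH IH)
    qed
    then have "\<forall>xs y. computes B (PRec p r) xs y \<longrightarrow> computes C (PRec p' r') xs y"
      by (metis computes_PRecE)
    then show ?case by blast
  next
    case (PMin p)
    then obtain p' where IH: "\<And>xs y. computes B p xs y \<Longrightarrow> computes C p' xs y" by blast
    have "computes C (PMin p') xs y" if "computes B (PMin p) xs y" for xs y
      using that
    proof (rule computes_PMinE)
      assume 0: "computes B p (y # xs) 0"
        and less: "\<And>m. m < y \<Longrightarrow> \<exists>w>0. computes B p (m # xs) w"
      show ?thesis
      proof (rule computes.min)
        show "computes C p' (y # xs) 0" using 0 by (rule IH)
        show "\<exists>w>0. computes C p' (m # xs) w" if "m < y" for m
          using less[OF that] IH by blast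
      qed
    qed
    then show ?case by blast
  next
    case PQuery
    have "computes B PQuery xs y \<longrightarrow> computes C q xs y" for xs y
      using q by (auto elim: computes_PQueryE)
    then show ?case by blast
  next
    case PZero
    have "computes B PZero xs y \<longrightarrow> computes C PZero xs y" for xs y
      by (auto elim: computes_PZeroE intro: computes.zero)
    then show ?case by blast
  next
    case PSucc
    have "computes B PSucc xs y \<longrightarrow> computes C PSucc xs y" for xs y
      by (auto elim: computes_PSuccE intro: computes.succ)
    then show ?case by blast
  next
    case (PProj i)
    have "computes B (PProj i) xs y \<longrightarrow> computes C (PProj i) xs y" for xs y
      by (auto elim: computes_PProjE intro: computes.proj)
    then show ?case by blast
  qed
  with \<open>A \<le>\<^sub>T B\<close> show ?thesis unfolding turing_le_def by meson
qed

definition turing_equiv :: "nat set rel" where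
  "turing_equiv = {(A, B). A \<equiv>\<^sub>T B}"

lemma equiv_turing_equiv: "equiv UNIV turing_equiv"
proof (rule equivI)
  show "refl turing_equiv"
    by (simp add: refl_on_def turing_equiv_def turing_eq_def turing_le_refl)
  show "sym turing_equiv"
    by (simp add: sym_def turing_equiv_def turing_eq_def)
  show "trans turing_equiv"
    unfolding trans_def turing_equiv_def turing_eq_def by (blast intro: turing_le_trans)
qed simp

definition turing_degrees :: "nat set set set" where
  "turing_degrees = UNIV // turing_equiv"

definition turing_degree :: "nat set \<Rightarrow> nat set set" where
  "turing_degree A = turing_equiv `` {A}"

definition degree_le :: "nat set set \<Rightarrow> nat set set \<Rightarrow> bool" where
  "degree_le a b \<longleftrightarrow> (\<exists>A\<in>a. \<exists>B\<in>b. A \<le>\<^sub>T B)"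

lemma degree_le_turing_degree: "degree_le (turing_degree A) (turing_degree B) \<longleftrightarrow> A \<le>\<^sub>T B"
  unfolding degree_le_def turing_degree_def turing_equiv_def turing_eq_def
  using turing_le_refl turing_le_trans by blast

definition turing_join :: "nat set \<Rightarrow> nat set \<Rightarrow> nat set"  (infixr "\<oplus>" 65) where
  "A \<oplus> B = (\<lambda>a. 2 * a) ` A \<union> (\<lambda>b. 2 * b + 1) ` B"


section \<open>Coding words and word-valued functions by numbers\<close>

text \<open>Bijective base-2 notation, least significant digit first.\<close>

fun word_code :: "bool list \<Rightarrow> nat" where
  "word_code [] = 0"
| "word_code (b # w) = 2 * word_code w + (if b then 2 else 1)"

lemma bij_word_code: "bij word_code"
proof (rule bijI)
  have "word_code u = word_code v \<Longrightarrow> u = v" for u v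
  proof (induction u arbitrary: v)
    case Nil
    then show ?case by (cases v) (auto split: if_splits)
  next
    case (Cons b u)
    obtain c w where v: "v = c # w"
      using Cons.prems by (cases v) (auto split: if_splits)
    with Cons.prems have *: "2 * word_code u + (if b then 2 else 1) = 2 * word_code w + (if c then 2 else 1)"
      by simp
    then have "b = c" by (cases b; cases c) (simp_all, presburger+)
    with * Cons.IH v show ?case by simp
  qed
  then show "inj word_code" by (rule injI)
  have "\<exists>w. n = word_code w" for n
  proof (induction n rule: less_induct)
    case (less n)
    show ?case
    proof (cases "n = 0")
      case True
      then show ?thesis by (metis word_code.simps(1))
    next
      case False
      then have "(n - 1) div 2 < n" by linarith
      then obtain w where w: "(n - 1) div 2 = word_code w"
        using less.IH by blast
      have "n = word_code (even n # w)"
        using False by (simp add: w[symmetric]) presburger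
      then show ?thesis by blast
    qed
  qed
  then show "surj word_code" by (auto simp: surj_def)
qed

definition word_fun_graph :: "(nat \<Rightarrow> bool list) \<Rightarrow> nat set" where
  "word_fun_graph f = range (\<lambda>n. prod_encode (n, word_code (f n)))"

end

theory Submission
  imports Defs "HOL-Library.Ramsey"
begin

text \<open>Recurrent words with the same factors have the same monadic theory: satisfaction of a formula
  is invariant under replacing the blocks of a \<open>\<int>\<close>-indexed factorisation by blocks equivalent
  for a congruence of finite index. A recurrent word factors into types \<open>e\<^sup>\<omega>\<^sup>* s e\<^sup>\<omega>\<close> with
  \<open>e\<close> an idempotent of the minimal \<open>\<J>\<close>-class met by its factors and \<open>s\<close> in the group of \<open>e\<close>;
  since \<open>s\<^sup>n = e\<close> for some \<open>n\<close>, the factor \<open>s\<close> can be absorbed.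

  So it suffices to code a set \<open>A\<close> in the given degree into a recurrent word with the factors of \<open>\<xi>\<close>.
  As \<open>\<xi>\<close> is not periodic, each factor has two extensions that differ on its left and on its right.
  Starting from a factor, extend it repeatedly; at stage \<open>k\<close> the choice between two such extensions
  (the least ones in the enumeration \<open>f\<close>, both containing \<open>f k\<close> on either side) records whether
  \<open>k \<in> A\<close>. Either half of the limit word together with \<open>f\<close> suffices to retrace the choices.\<close>

section \<open>Factorisations of bi-infinite words\<close>

text \<open>The idempotent is chosen by conditions on the common set of factors only, so one class
  serves both words. Equality of classes is not composed through an intermediate word, whose two
  factorisations need not match; instead the truth of the sentence is passed along a chain of three
  comparisons. No finite monoid is built as an object: its elements are represented by words, and
  Green's relations become equations between values of \<open>h\<close>. In the coding, either half
  has to reveal every bit on its own, so one pair of extensions must differ on both sides at once.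
  Branching on a single side follows directly from non-periodicity; combining the sides is the task
  of \<open>two_sided_branching\<close>. The search for extensions refers to \<open>f\<close> and
  never to \<xi>, so it can be repeated from \<open>f\<close> and the bits found so far.\<close>

definition seg :: "(int \<Rightarrow> 'a) \<Rightarrow> int \<Rightarrow> int \<Rightarrow> 'a list" where
  "seg x a b = map x [a..b - 1]"

lemma length_seg [simp]: "length (seg x a b) = nat (b - a)"
  by (simp add: seg_def)

lemma nth_seg: "i < nat (b - a) \<Longrightarrow> seg x a b ! i = x (a + int i)"
  by (simp add: seg_def)

lemma set_seg: "set (seg x a b) = x ` {a..<b}"
  by (force simp: seg_def)

lemma seg_append: "a \<le> b \<Longrightarrow> b \<le> c \<Longrightarrow> seg x a b @ seg x b c = seg x a c"
  using upto_split1[of a b "c - 1"] upto_Nil[of b "c-1"]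
  by (cases "b = c") (auto simp: seg_def simp flip: map_append)

lemma seg_map: "seg (\<lambda>p. g (x p)) a b = map g (seg x a b)"
  by (simp add: seg_def)

lemma seg_eq_iff:
  "seg x a b = w \<longleftrightarrow> length w = nat (b - a) \<and> (\<forall>i < nat (b - a). w ! i = x (a + int i))"
  by (auto simp: nth_seg list_eq_iff_nth_eq)

lemma strict_mono_int_growth:
  fixes t :: "int \<Rightarrow> int"
  assumes "strict_mono t"
  shows "t i + int n \<le> t (i + int n)"
proof (induction n)
  case (Suc n)
  have "t (i + int n) < t (i + int (Suc n))"
    using assms by (simp add: strict_mono_def)
  with Suc show ?case by simp
qed simp

lemma strict_mono_block:
  fixes t :: "int \<Rightarrow> int"
  assumes t: "strict_mono t"
  shows "\<exists>i. t i \<le> p \<and> p < t (i + 1)"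
proof -
  define k where "k = - int (nat (\<bar>p\<bar> + \<bar>t 0\<bar>))"
  have "t k \<le> p"
    using strict_mono_int_growth[OF t, of k "nat (- k)"] by (simp add: k_def)
  define Q where "Q n \<longleftrightarrow> p < t (k + int n + 1)" for n
  have "Q (nat (\<bar>p\<bar> + \<bar>t k\<bar>))"
    using strict_mono_int_growth[OF t, of k "nat (\<bar>p\<bar> + \<bar>t k\<bar>) + 1"] unfolding Q_def
    by (simp add: add_ac)
  then have L: "Q (LEAST n. Q n)" by (rule LeastI)
  show ?thesis
  proof (cases "LEAST n. Q n")
    case 0
    then show ?thesis using L \<open>t k \<le> p\<close> by (auto simp: Q_def)
  next
    case (Suc m)
    then have "\<not> Q m" using not_less_Least[of m Q] by simp
    then have "t (k + int m + 1) \<le> p" by (simp add: Q_def)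
    moreover have "p < t (k + int m + 1 + 1)" using L Suc by (simp add: Q_def add_ac)
    ultimately show ?thesis by blast
  qed
qed

lemma strict_mono_block_unique:
  fixes t :: "int \<Rightarrow> int"
  assumes t: "strict_mono t" and "t i \<le> p" "p < t (i + 1)" "t j \<le> p" "p < t (j + 1)"
  shows "i = j"
proof -
  have "i < j + 1" "j < i + 1" using assms strict_mono_less[OF t] by (meson le_less_trans)+
  then show ?thesis by simp
qed

text \<open>Quantified variables will be interpreted block by block; this assembles the chosen
  blocks into one word.\<close>

lemma glue:
  fixes t :: "int \<Rightarrow> int"
  assumes t: "strict_mono t" and len: "\<And>i. length (w i) = nat (t (i + 1) - t i)"
  shows "\<exists>x. \<forall>i. seg x (t i) (t (i + 1)) = w i"
proof -
  define b where "b p = (SOME i. t i \<le> p \<and> p < t (i + 1))" for p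
  have b: "b p = i" if "t i \<le> p" "p < t (i + 1)" for p i
    unfolding b_def using that strict_mono_block_unique[OF t] by (intro some_equality) auto
  define x where "x p = w (b p) ! nat (p - t (b p))" for p
  have "seg x (t i) (t (i + 1)) = w i" for i
    unfolding seg_eq_iff by (auto simp: len x_def b[of i])
  then show ?thesis by blast
qed

section \<open>Recognising monadic second-order formulas\<close>

text \<open>\<open>h\<close> plays the role of a morphism onto a finite monoid. Classes are numbers
  because pairs and finite sets of classes can again be coded as numbers, which keeps the type fixed
  along the induction on formulas.\<close>

definition congr :: "('a list \<Rightarrow> nat) \<Rightarrow> bool" where
  "congr h \<longleftrightarrow> finite (range h) \<and>
     (\<forall>u u' v v'. h u = h u' \<longrightarrow> h v = h v' \<longrightarrow> h (u @ v) = h (u' @ v'))"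

text \<open>A strictly increasing map on the integers is unbounded on both sides, so the blocks are
  non-empty and cover the whole word.\<close>

definition blockwise_eq :: "('a list \<Rightarrow> nat) \<Rightarrow> (int \<Rightarrow> 'a) \<Rightarrow> (int \<Rightarrow> 'a) \<Rightarrow> bool" where
  "blockwise_eq h x y \<longleftrightarrow> (\<exists>(t :: int \<Rightarrow> int) (t' :: int \<Rightarrow> int). strict_mono t \<and> strict_mono t' \<and>
     (\<forall>i. h (seg x (t i) (t (i + 1))) = h (seg y (t' i) (t' (i + 1)))))"

lemma blockwise_eq_sym:
  assumes "blockwise_eq h x y"
  shows "blockwise_eq h y x"
proof -
  obtain t t' :: "int \<Rightarrow> int" where "strict_mono t" "strict_mono t'"
      "\<forall>i. h (seg x (t i) (t (i + 1))) = h (seg y (t' i) (t' (i + 1)))"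
    using assms unfolding blockwise_eq_def by blast
  then show ?thesis
    unfolding blockwise_eq_def by (intro exI[of _ t'] exI[of _ t] conjI) simp_all
qed

lemma congr_pair:
  assumes "congr g" "congr h"
  shows "congr (\<lambda>w. prod_encode (g w, h w))"
proof -
  have "range (\<lambda>w. prod_encode (g w, h w)) \<subseteq> prod_encode ` (range g \<times> range h)" by auto
  moreover have "finite (prod_encode ` (range g \<times> range h))"
    using assms by (simp add: congr_def)
  ultimately have "finite (range (\<lambda>w. prod_encode (g w, h w)))" by (rule finite_subset)
  then show ?thesis using assms unfolding congr_def prod_encode_eq prod.inject by blast
qed

section \<open>Congruences for occurrence, order and number of letters\<close>

lemma congr_of_bool_ex: "congr (\<lambda>w. of_bool (\<exists>l\<in>set w. Q l))"
proof -
  have "range (\<lambda>w. of_bool (\<exists>l\<in>set w. Q l)) \<subseteq> {0, 1 :: nat}" by auto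
  then have "finite (range (\<lambda>w. of_bool (\<exists>l\<in>set w. Q l) :: nat))" by (rule finite_subset) simp
  then show ?thesis
    unfolding congr_def of_bool_eq_iff set_append bex_Un by blast
qed

definition before :: "('a \<Rightarrow> bool) \<Rightarrow> ('a \<Rightarrow> bool) \<Rightarrow> 'a list \<Rightarrow> bool" where
  "before Q R w \<longleftrightarrow> (\<exists>i j. i \<le> j \<and> j < length w \<and> Q (w ! i) \<and> R (w ! j))"

lemma before_append:
  "before Q R (u @ v) \<longleftrightarrow> before Q R u \<or> before Q R v \<or> (\<exists>l\<in>set u. Q l) \<and> (\<exists>l\<in>set v. R l)"
    (is "?l \<longleftrightarrow> ?r")
proof
  assume ?l
  then obtain i j where ij: "i \<le> j" "j < length u + length v" "Q ((u @ v) ! i)" "R ((u @ v) ! j)"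
    by (auto simp: before_def)
  consider "j < length u" | "i < length u" "length u \<le> j" | "length u \<le> i" by linarith
  then show ?r
  proof cases
    case 1
    then have "before Q R u" using ij unfolding before_def by (auto simp: nth_append)
    then show ?thesis ..
  next
    case 2
    then have "Q (u ! i)" "R (v ! (j - length u))" "j - length u < length v"
      using ij by (auto simp: nth_append)
    then show ?thesis using 2 nth_mem by blast
  next
    case 3
    then have "before Q R v" using ij unfolding before_def
      by (intro exI[of _ "i - length u"] exI[of _ "j - length u"]) (auto simp: nth_append)
    then show ?thesis by blast
  qed
next
  assume ?r
  then consider "before Q R u" | "before Q R v" | "\<exists>l\<in>set u. Q l" "\<exists>l\<in>set v. R l" by blast
  then show ?l
  proof cases
    case 1
    then obtain i j where "i \<le> j" "j < length u" "Q (u ! i)" "R (u ! j)" by (auto simp: before_def)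
    then show ?thesis unfolding before_def
      by (intro exI[of _ i] exI[of _ j]) (auto simp: nth_append)
  next
    case 2
    then obtain i j where "i \<le> j" "j < length v" "Q (v ! i)" "R (v ! j)" by (auto simp: before_def)
    then show ?thesis unfolding before_def
      by (intro exI[of _ "length u + i"] exI[of _ "length u + j"]) (auto simp: nth_append)
  next
    case 3
    then obtain i j where "i < length u" "Q (u ! i)" "j < length v" "R (v ! j)"
      by (auto simp: in_set_conv_nth)
    then show ?thesis unfolding before_def
      by (intro exI[of _ i] exI[of _ "length u + j"]) (auto simp: nth_append)
  qed
qed

lemma before_seg: "before Q R (seg x a b) \<longleftrightarrow> (\<exists>p q. a \<le> p \<and> p \<le> q \<and> q < b \<and> Q (x p) \<and> R (x q))"
    (is "?l \<longleftrightarrow> ?r")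
proof
  assume ?l
  then obtain i j where "i \<le> j" "j < nat (b - a)" "Q (x (a + int i))" "R (x (a + int j))"
    by (auto simp: before_def nth_seg)
  then show ?r by (intro exI[of _ "a + int i"] exI[of _ "a + int j"]) auto
next
  assume ?r
  then obtain p q where "a \<le> p" "p \<le> q" "q < b" "Q (x p)" "R (x q)" by blast
  then show ?l unfolding before_def
    by (intro exI[of _ "nat (p - a)"] exI[of _ "nat (q - a)"]) (auto simp: nth_seg)
qed

text \<open>On a concatenation, \<open>before\<close> also depends on whether \<open>Q\<close>
  occurs in the left part and \<open>R\<close> in the right part, so these two bits are carried
  along.\<close>

lemma congr_before:
  "congr (\<lambda>w. prod_encode (of_bool (before Q R w),
     prod_encode (of_bool (\<exists>l\<in>set w. Q l), of_bool (\<exists>l\<in>set w. R l))))"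
  (is "congr ?h")
proof -
  let ?c = "\<lambda>(a, b, c). prod_encode (of_bool a, prod_encode (of_bool b, of_bool c))"
  have "?h w \<in> range ?c" for w
    using rangeI[of ?c "(before Q R w, \<exists>l\<in>set w. Q l, \<exists>l\<in>set w. R l)"] by simp
  then have "range ?h \<subseteq> range ?c" by blast
  then have "finite (range ?h)" by (rule finite_subset) simp
  moreover have "?h (u @ v) = ?h (u' @ v')" if "?h u = ?h u'" "?h v = ?h v'" for u u' v v'
  proof -
    have "before Q R u \<longleftrightarrow> before Q R u'" "(\<exists>l\<in>set u. Q l) \<longleftrightarrow> (\<exists>l\<in>set u'. Q l)"
      "(\<exists>l\<in>set u. R l) \<longleftrightarrow> (\<exists>l\<in>set u'. R l)" "before Q R v \<longleftrightarrow> before Q R v'"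
      "(\<exists>l\<in>set v. Q l) \<longleftrightarrow> (\<exists>l\<in>set v'. Q l)" "(\<exists>l\<in>set v. R l) \<longleftrightarrow> (\<exists>l\<in>set v'. R l)"
      using that unfolding prod_encode_eq prod.inject of_bool_eq_iff by iprover+
    then show ?thesis by (simp only: before_append set_append bex_Un)
  qed
  ultimately show ?thesis unfolding congr_def by blast
qed

text \<open>Capping at 2 keeps the count finite and still separates none, exactly one and several.
  This later forces a guessed set to be a singleton.\<close>

lemma congr_min_count: "congr (\<lambda>w. min 2 (length (filter Q w)))"
proof -
  have "range (\<lambda>w. min 2 (length (filter Q w))) \<subseteq> {..2}" by auto
  then have "finite (range (\<lambda>w. min 2 (length (filter Q w))))" by (rule finite_subset) simp
  moreover have "min 2 (length (filter Q (u @ v))) = min 2 (length (filter Q (u' @ v')))"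
    if "min 2 (length (filter Q u)) = min 2 (length (filter Q u'))"
      "min 2 (length (filter Q v)) = min 2 (length (filter Q v'))" for u u' v v'
    using that by (simp add: min_def split: if_splits)
  ultimately show ?thesis unfolding congr_def by blast
qed

text \<open>The power construction behind both quantifiers: all classes reachable by relabelling
  along \<open>r\<close>. \<open>set_encode\<close> is injective on finite sets only, which the
  finite range of \<open>g\<close> provides.\<close>

definition variants :: "('a \<Rightarrow> 'a \<Rightarrow> bool) \<Rightarrow> ('a list \<Rightarrow> nat) \<Rightarrow> 'a list \<Rightarrow> nat" where
  "variants r g w = set_encode (g ` {w'. list_all2 r w w'})"

lemma variants_eqD:
  assumes "congr g" "variants r g u = variants r g v" "list_all2 r u u'"
  shows "\<exists>v'. list_all2 r v v' \<and> g v' = g u'"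
proof -
  have "finite (g ` A)" for A using assms(1) by (meson congr_def finite_subset image_mono subset_UNIV)
  then have "g ` {w'. list_all2 r u w'} = g ` {w'. list_all2 r v w'}"
    using assms(2) by (simp add: variants_def set_encode_eq)
  with assms(3) show ?thesis by (metis (mono_tags, lifting) imageE image_eqI mem_Collect_eq)
qed

lemma congr_variants:
  assumes g: "congr g"
  shows "congr (variants r g)"
proof -
  have "range (variants r g) \<subseteq> set_encode ` Pow (range g)" by (auto simp: variants_def)
  moreover have "finite (set_encode ` Pow (range g))" using g by (simp add: congr_def)
  ultimately have fin: "finite (range (variants r g))" by (rule finite_subset)
  have *: "g ` {w'. list_all2 r (u @ v) w'} \<subseteq> g ` {w'. list_all2 r (u' @ v') w'}"
    if "variants r g u = variants r g u'" "variants r g v = variants r g v'" for u u' v v'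
  proof
    fix c assume "c \<in> g ` {w'. list_all2 r (u @ v) w'}"
    then obtain a b where ab: "list_all2 r u a" "list_all2 r v b" "c = g (a @ b)"
      by (auto simp: list_all2_append1)
    from variants_eqD[OF g that(1) ab(1)] variants_eqD[OF g that(2) ab(2)]
    obtain a' b' where "list_all2 r u' a'" "list_all2 r v' b'" "g a' = g a" "g b' = g b" by blast
    moreover from this have "g (a' @ b') = c" using g ab(3) unfolding congr_def by blast
    ultimately show "c \<in> g ` {w'. list_all2 r (u' @ v') w'}"
      by (auto intro!: image_eqI[of _ _ "a' @ b'"] list_all2_appendI)
  qed
  have "variants r g (u @ v) = variants r g (u' @ v')"
    if "variants r g u = variants r g u'" "variants r g v = variants r g v'" for u u' v v'
    unfolding variants_def using *[OF that] *[OF that[symmetric]] by (metis subset_antisym)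
  with fin show ?thesis unfolding congr_def by blast
qed

text \<open>Each block of \<open>y\<close> has a relabelling of the required class. The blocks are
  disjoint and cover the line, so these choices can be made independently.\<close>

lemma variants_lift:
  fixes t t' :: "int \<Rightarrow> int"
  assumes g: "congr g" and t: "strict_mono t" "strict_mono t'"
    and eq: "\<And>i. variants r g (seg x (t i) (t (i + 1))) = variants r g (seg y (t' i) (t' (i + 1)))"
    and r: "\<And>p. r (x p) (x' p)"
  shows "\<exists>y'. (\<forall>p. r (y p) (y' p)) \<and>
    (\<forall>i. g (seg x' (t i) (t (i + 1))) = g (seg y' (t' i) (t' (i + 1))))"
proof -
  have "list_all2 r (seg x a b) (seg x' a b)" for a b
    using r by (auto simp: list_all2_conv_all_nth nth_seg)
  then have "\<forall>i. \<exists>w. list_all2 r (seg y (t' i) (t' (i + 1))) w \<and> g w = g (seg x' (t i) (t (i + 1)))"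
    using variants_eqD[OF g eq] by blast
  then obtain w where w: "\<And>i. list_all2 r (seg y (t' i) (t' (i + 1))) (w i)"
      "\<And>i. g (w i) = g (seg x' (t i) (t (i + 1)))"
    by metis
  have "length (w i) = nat (t' (i + 1) - t' i)" for i
    using list_all2_lengthD[OF w(1)[of i]] by simp
  then obtain y' where y': "\<And>i. seg y' (t' i) (t' (i + 1)) = w i"
    using glue[OF t(2)] by blast
  have "r (y p) (y' p)" for p
  proof -
    obtain i where i: "t' i \<le> p" "p < t' (i + 1)" using strict_mono_block[OF t(2)] by blast
    then have k: "nat (p - t' i) < nat (t' (i + 1) - t' i)" "t' i + int (nat (p - t' i)) = p" by auto
    have "list_all2 r (seg y (t' i) (t' (i + 1))) (seg y' (t' i) (t' (i + 1)))"
      using w(1)[of i] y' by simp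
    from list_all2_nthD[OF this, of "nat (p - t' i)"] k show ?thesis by (simp add: nth_seg)
  qed
  then show ?thesis using w(2) y' by metis
qed

section \<open>Invariance of formulas under suitable congruences\<close>

definition enc :: "nat set \<Rightarrow> nat set \<Rightarrow> int set \<Rightarrow> (nat \<Rightarrow> int) \<Rightarrow> (nat \<Rightarrow> int set) \<Rightarrow>
    int \<Rightarrow> bool \<times> nat set \<times> nat set" where
  "enc V U P e E p = (p \<in> P, {x\<in>V. e x = p}, {X\<in>U. p \<in> E X})"

text \<open>One implication is enough, since \<open>blockwise_eq\<close> is symmetric; the same
  symmetry settles negation.\<close>

definition recognises :: "((bool \<times> nat set \<times> nat set) list \<Rightarrow> nat) \<Rightarrow> nat set \<Rightarrow> nat set \<Rightarrow> mso \<Rightarrow> bool" where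
  "recognises h V U \<phi> \<longleftrightarrow> congr h \<and> (\<forall>P e E P' e' E'. blockwise_eq h (enc V U P e E) (enc V U P' e' E') \<longrightarrow>
     sat (\<le>) P e E \<phi> \<longrightarrow> sat (\<le>) P' e' E' \<phi>)"

lemma blockwise_eq_ex:
  assumes "blockwise_eq (\<lambda>w. of_bool (\<exists>l\<in>set w. Q l)) x y" and "Q (x p)"
  shows "\<exists>q. Q (y q)"
proof -
  obtain t t' :: "int \<Rightarrow> int" where t: "strict_mono t" "strict_mono t'"
    and eq: "\<And>i. (\<exists>l\<in>set (seg x (t i) (t (i + 1))). Q l) \<longleftrightarrow> (\<exists>l\<in>set (seg y (t' i) (t' (i + 1))). Q l)"
    using assms(1) unfolding blockwise_eq_def of_bool_eq_iff by blast
  obtain i where "t i \<le> p" "p < t (i + 1)" using strict_mono_block[OF t(1)] by blast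
  then show ?thesis using eq[of i] assms(2) by (auto simp: set_seg)
qed

lemma recognises_ex:
  assumes "\<And>P e E. sat (\<le>) P e E \<phi> \<longleftrightarrow> (\<exists>p. Q (enc V U P e E p))"
  shows "\<exists>h. recognises h V U \<phi>"
  using assms congr_of_bool_ex[of Q] blockwise_eq_ex[of Q] unfolding recognises_def by blast

text \<open>Within one block \<open>before\<close> decides. Positions in different blocks are
  ordered like the indices of their blocks, and these indices are shared by both
  factorisations.\<close>

lemma recognises_Leq:
  assumes "x \<in> V" "y \<in> V"
  shows "\<exists>h. recognises h V U (Leq x y)"
proof -
  define Q where "Q z = (\<lambda>l :: bool \<times> nat set \<times> nat set. z \<in> fst (snd l))" for z
  define h where "h w = prod_encode (of_bool (before (Q x) (Q y) w),
     prod_encode (of_bool (\<exists>l\<in>set w. Q x l), of_bool (\<exists>l\<in>set w. Q y l)))" for w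
  have "sat (\<le>) P' e' E' (Leq x y)"
    if m: "blockwise_eq h (enc V U P e E) (enc V U P' e' E')" and s: "sat (\<le>) P e E (Leq x y)"
    for P e E P' e' E'
  proof -
    let ?w = "enc V U P e E" and ?w' = "enc V U P' e' E'"
    have Q: "Q z (enc V U P e E p) \<longleftrightarrow> p = e z" if "z \<in> {x, y}" for z p P e E
      using that assms by (auto simp: Q_def enc_def)
    obtain t t' :: "int \<Rightarrow> int" where t: "strict_mono t" "strict_mono t'"
      and h: "\<And>i. h (seg ?w (t i) (t (i + 1))) = h (seg ?w' (t' i) (t' (i + 1)))"
      using m unfolding blockwise_eq_def by blast
    have b: "before (Q x) (Q y) (seg ?w (t i) (t (i + 1))) \<longleftrightarrow>
        before (Q x) (Q y) (seg ?w' (t' i) (t' (i + 1)))"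
      and o: "z \<in> {x, y} \<Longrightarrow> (\<exists>l\<in>set (seg ?w (t i) (t (i + 1))). Q z l) \<longleftrightarrow>
        (\<exists>l\<in>set (seg ?w' (t' i) (t' (i + 1))). Q z l)" for i z
      using h[of i] unfolding h_def prod_encode_eq prod.inject of_bool_eq_iff by blast+
    obtain i where i: "t i \<le> e x" "e x < t (i + 1)" using strict_mono_block[OF t(1)] by blast
    obtain j where j: "t j \<le> e y" "e y < t (j + 1)" using strict_mono_block[OF t(1)] by blast
    have le: "e x \<le> e y" using s by simp
    have "t i < t (j + 1)" using i j le by linarith
    then have "i \<le> j" using strict_mono_less[OF t(1)] by simp
    show ?thesis
    proof (cases "i = j")
      case True
      then have "before (Q x) (Q y) (seg ?w (t i) (t (i + 1)))"
        using i j le by (auto simp: before_seg Q)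
      then have "before (Q x) (Q y) (seg ?w' (t' i) (t' (i + 1)))" using b by blast
      then show ?thesis by (auto simp: before_seg Q)
    next
      case False
      then have "t' (i + 1) \<le> t' j" using \<open>i \<le> j\<close> strict_mono_less_eq[OF t(2)] by simp
      moreover have "e' x < t' (i + 1)" "t' j \<le> e' y"
        using o[of x i] o[of y j] i j by (auto simp: set_seg Q)
      ultimately show ?thesis by simp
    qed
  qed
  moreover have "congr h" unfolding h_def by (rule congr_before)
  ultimately show ?thesis unfolding recognises_def by blast
qed

lemma recognises_Conj:
  assumes "recognises g V U \<phi>" "recognises h V U \<psi>"
  shows "recognises (\<lambda>w. prod_encode (g w, h w)) V U (Conj \<phi> \<psi>)"
proof -
  have "blockwise_eq g x y" "blockwise_eq h x y"
    if "blockwise_eq (\<lambda>w. prod_encode (g w, h w)) x y" for x y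
    using that unfolding blockwise_eq_def prod_encode_eq prod.inject by blast+
  then show ?thesis using assms congr_pair unfolding recognises_def sat.simps by blast
qed

lemma recognises_ExSet:
  assumes "recognises g V (insert X U) \<phi>"
  shows "\<exists>h. recognises h V U (ExSet X \<phi>)"
proof -
  \<comment> \<open>Removing \<open>X\<close> on both sides also covers the case that
    \<open>X\<close> already lies in \<open>U\<close>: its old value is forgotten.\<close>
  define r where "r = (\<lambda>l l' :: bool \<times> nat set \<times> nat set. fst l = fst l' \<and> fst (snd l) = fst (snd l') \<and>
    snd (snd l) - {X} = snd (snd l') - {X})"
  have g: "congr g" using assms by (simp add: recognises_def)
  have "sat (\<le>) P' e' E' (ExSet X \<phi>)"
    if m: "blockwise_eq (variants r g) (enc V U P e E) (enc V U P' e' E')"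
      and s: "sat (\<le>) P e E (ExSet X \<phi>)" for P e E P' e' E'
  proof -
    obtain A where A: "sat (\<le>) P e (E(X := A)) \<phi>" using s by auto
    let ?w = "enc V (insert X U) P e (E(X := A))"
    obtain t t' :: "int \<Rightarrow> int" where t: "strict_mono t" "strict_mono t'"
      and eq: "\<And>i. variants r g (seg (enc V U P e E) (t i) (t (i + 1))) =
        variants r g (seg (enc V U P' e' E') (t' i) (t' (i + 1)))"
      using m unfolding blockwise_eq_def by blast
    have "r (enc V U P e E p) (?w p)" for p by (auto simp: r_def enc_def)
    from variants_lift[OF g t eq this] obtain y where y: "\<And>p. r (enc V U P' e' E' p) (y p)"
      and gy: "\<And>i. g (seg ?w (t i) (t (i + 1))) = g (seg y (t' i) (t' (i + 1)))" by blast
    define A' where "A' = {p. X \<in> snd (snd (y p))}"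
    have "y = enc V (insert X U) P' e' (E'(X := A'))"
    proof
      fix p
      show "y p = enc V (insert X U) P' e' (E'(X := A')) p"
        using y[of p] unfolding r_def enc_def A'_def
        by (cases "y p") (auto split: if_splits)
    qed
    then have "blockwise_eq g ?w (enc V (insert X U) P' e' (E'(X := A')))"
      using t gy unfolding blockwise_eq_def by blast
    then have "sat (\<le>) P' e' (E'(X := A')) \<phi>" using A assms unfolding recognises_def by blast
    then show ?thesis by auto
  qed
  then show ?thesis using congr_variants[OF g, of r] unfolding recognises_def by blast
qed

text \<open>The element is guessed as a set of positions. Equal capped counts give this set one
  member in block \<open>i0\<close> and none in any other block.\<close>

lemma recognises_ExElem:
  assumes "recognises g (insert x V) U \<phi>"
  shows "\<exists>h. recognises h V U (ExElem x \<phi>)"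
proof -
  define r where "r = (\<lambda>l l' :: bool \<times> nat set \<times> nat set. fst l = fst l' \<and> snd (snd l) = snd (snd l') \<and>
    fst (snd l) - {x} = fst (snd l') - {x})"
  define Q where "Q = (\<lambda>l :: bool \<times> nat set \<times> nat set. x \<in> fst (snd l))"
  define g' where "g' w = prod_encode (g w, min 2 (length (filter Q w)))" for w
  have g': "congr g'"
    using assms unfolding g'_def recognises_def by (intro congr_pair congr_min_count) auto
  have count: "length (filter Q (seg w a b)) = card {p. a \<le> p \<and> p < b \<and> Q (w p)}" for w a b
  proof -
    have "length (filter Q (seg w a b)) = card ({p. (Q \<circ> w) p} \<inter> set [a..b - 1])"
      unfolding seg_def by (simp add: filter_map distinct_length_filter)
    also have "{p. (Q \<circ> w) p} \<inter> set [a..b - 1] = {p. a \<le> p \<and> p < b \<and> Q (w p)}" by auto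
    finally show ?thesis .
  qed
  have "sat (\<le>) P' e' E' (ExElem x \<phi>)"
    if m: "blockwise_eq (variants r g') (enc V U P e E) (enc V U P' e' E')"
      and s: "sat (\<le>) P e E (ExElem x \<phi>)" for P e E P' e' E'
  proof -
    obtain a where a: "sat (\<le>) P (e(x := a)) E \<phi>" using s by auto
    let ?w = "enc (insert x V) U P (e(x := a)) E"
    obtain t t' :: "int \<Rightarrow> int" where t: "strict_mono t" "strict_mono t'"
      and eq: "\<And>i. variants r g' (seg (enc V U P e E) (t i) (t (i + 1))) =
        variants r g' (seg (enc V U P' e' E') (t' i) (t' (i + 1)))"
      using m unfolding blockwise_eq_def by blast
    have "r (enc V U P e E p) (?w p)" for p by (auto simp: r_def enc_def)
    from variants_lift[OF g' t eq this] obtain y where y: "\<And>p. r (enc V U P' e' E' p) (y p)"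
      and gy': "\<And>i. g' (seg ?w (t i) (t (i + 1))) = g' (seg y (t' i) (t' (i + 1)))" by blast
    from gy' have gy: "g (seg ?w (t i) (t (i + 1))) = g (seg y (t' i) (t' (i + 1)))"
      and cy: "min 2 (length (filter Q (seg ?w (t i) (t (i + 1))))) =
        min 2 (length (filter Q (seg y (t' i) (t' (i + 1)))))" for i
      by (auto simp: g'_def prod_encode_eq)
    have Qw: "Q (?w p) \<longleftrightarrow> p = a" for p by (auto simp: Q_def enc_def)
    obtain i0 where i0: "t i0 \<le> a" "a < t (i0 + 1)" using strict_mono_block[OF t(1)] by blast
    have "{p. t i0 \<le> p \<and> p < t (i0 + 1) \<and> Q (?w p)} = {a}" using i0 by (auto simp: Qw)
    then have "length (filter Q (seg ?w (t i0) (t (i0 + 1)))) = 1" by (simp add: count)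
    then have "card {p. t' i0 \<le> p \<and> p < t' (i0 + 1) \<and> Q (y p)} = 1"
      using cy[of i0] by (auto simp: count min_def split: if_splits)
    then obtain a' where a': "{p. t' i0 \<le> p \<and> p < t' (i0 + 1) \<and> Q (y p)} = {a'}"
      by (auto simp: card_1_singleton_iff)
    have Qy: "Q (y p) \<longleftrightarrow> p = a'" for p
    proof
      show "Q (y p)" if "p = a'" using that a' by blast
      assume Q: "Q (y p)"
      obtain i where i: "t' i \<le> p" "p < t' (i + 1)" using strict_mono_block[OF t(2)] by blast
      show "p = a'"
      proof (cases "i = i0")
        case True
        then show ?thesis using a' i Q by blast
      next
        case False
        have fin: "finite {p. t' i \<le> p \<and> p < t' (i + 1) \<and> Q (y p)}"
          by (rule finite_subset[of _ "{t' i..t' (i + 1)}"]) auto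
        have "{p. t i \<le> p \<and> p < t (i + 1) \<and> Q (?w p)} = {}"
          using False strict_mono_block_unique[OF t(1) i0] by (auto simp: Qw)
        then have "length (filter Q (seg ?w (t i) (t (i + 1)))) = 0" by (simp only: count card.empty)
        then have "card {p. t' i \<le> p \<and> p < t' (i + 1) \<and> Q (y p)} = 0"
          using cy[of i] by (simp add: count min_def split: if_splits)
        then show ?thesis using fin i Q by auto
      qed
    qed
    have "y = enc (insert x V) U P' (e'(x := a')) E'"
    proof
      fix p
      show "y p = enc (insert x V) U P' (e'(x := a')) E' p"
        using y[of p] Qy[of p] unfolding r_def enc_def Q_def
        by (cases "y p") (auto split: if_splits)
    qed
    then have "blockwise_eq g ?w (enc (insert x V) U P' (e'(x := a')) E')"
      using t gy unfolding blockwise_eq_def by blast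
    then have "sat (\<le>) P' (e'(x := a')) E' \<phi>" using a assms unfolding recognises_def by blast
    then show ?thesis by auto
  qed
  then show ?thesis using congr_variants[OF g', of r] unfolding recognises_def by blast
qed

lemma recognisable:
  assumes "free_elem \<phi> \<subseteq> V" "free_set \<phi> \<subseteq> U"
  shows "\<exists>h. recognises h V U \<phi>"
  using assms
proof (induction \<phi> arbitrary: V U)
  case (Equal x y)
  then show ?case
    by (intro recognises_ex[where Q = "\<lambda>l. x \<in> fst (snd l) \<and> y \<in> fst (snd l)"]) (auto simp: enc_def)
next
  case (Leq x y)
  then show ?case by (intro recognises_Leq) auto
next
  case (Pred x)
  then show ?case
    by (intro recognises_ex[where Q = "\<lambda>l. x \<in> fst (snd l) \<and> fst l"]) (auto simp: enc_def)
next
  case (Member x X)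
  then show ?case
    by (intro recognises_ex[where Q = "\<lambda>l. x \<in> fst (snd l) \<and> X \<in> snd (snd l)"]) (auto simp: enc_def)
next
  case (Neg \<phi>)
  have "\<exists>h. recognises h V U \<phi>" using Neg.prems by (intro Neg.IH) auto
  then obtain h where "recognises h V U \<phi>" ..
  then have "recognises h V U (Neg \<phi>)"
    unfolding recognises_def using blockwise_eq_sym by (auto, blast)
  then show ?case by blast
next
  case (Conj \<phi> \<psi>)
  have "\<exists>g. recognises g V U \<phi>" "\<exists>h. recognises h V U \<psi>"
    using Conj.prems by (intro Conj.IH; auto)+
  then show ?case using recognises_Conj by blast
next
  case (ExElem x \<phi>)
  then have "\<exists>g. recognises g (insert x V) U \<phi>" by (intro ExElem.IH) auto
  then show ?case using recognises_ExElem by blast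
next
  case (ExSet X \<phi>)
  then have "\<exists>g. recognises g V (insert X U) \<phi>" by (intro ExSet.IH) auto
  then show ?case using recognises_ExSet by blast
qed

lemma sentence_recognisable:
  assumes "sentence \<phi>"
  shows "\<exists>h :: bool list \<Rightarrow> nat. congr h \<and> (\<forall>\<xi> \<eta>. blockwise_eq h \<xi> \<eta> \<longrightarrow>
    (\<forall>e E. sat (\<le>) (\<xi> -` {True}) e E \<phi>) \<longrightarrow> (\<forall>e E. sat (\<le>) (\<eta> -` {True}) e E \<phi>))"
proof -
  obtain g where g: "recognises g {} {} \<phi>"
    using recognisable[of \<phi> "{}" "{}"] assms by (auto simp: sentence_def)
  \<comment> \<open>No variable is tracked, so a label amounts to a letter of the word.\<close>
  define l where "l = (\<lambda>b :: bool. (b, {} :: nat set, {} :: nat set))"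
  define h where "h w = g (map l w)" for w
  have enc: "enc {} {} (\<xi> -` {True}) e E = (\<lambda>p. l (\<xi> p))" for \<xi> e E
    by (auto simp: enc_def l_def)
  have "congr g" using g by (simp add: recognises_def)
  then have "congr h"
    unfolding congr_def h_def map_append
    by (metis (no_types, lifting) finite_subset image_subsetI rangeI)
  moreover have "sat (\<le>) (\<eta> -` {True}) e E \<phi>"
    if m: "blockwise_eq h \<xi> \<eta>" and s: "\<forall>e E. sat (\<le>) (\<xi> -` {True}) e E \<phi>" for \<xi> \<eta> e E
  proof -
    have "blockwise_eq g (enc {} {} (\<xi> -` {True}) e E) (enc {} {} (\<eta> -` {True}) e E)"
      using m unfolding blockwise_eq_def h_def enc seg_map .
    then show ?thesis using g s unfolding recognises_def by blast
  qed
  ultimately show ?thesis by blast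
qed

section \<open>The monadic theory of a recurrent word\<close>

lemma factors_eq: "factors \<xi> = range (\<lambda>(a, b). seg \<xi> a b)"
proof (intro equalityI subsetI)
  fix w assume "w \<in> factors \<xi>"
  then consider "w = seg \<xi> 0 0" | i j where "w = seg \<xi> i (j + 1)"
    by (auto simp: factors_on_def seg_def)
  then show "w \<in> range (\<lambda>(a, b). seg \<xi> a b)" by cases auto
next
  fix w assume "w \<in> range (\<lambda>(a, b). seg \<xi> a b)"
  then obtain a b where w: "w = map \<xi> [a..b - 1]" by (auto simp: seg_def)
  show "w \<in> factors \<xi>"
  proof (cases "a \<le> b - 1")
    case True
    then show ?thesis using w unfolding factors_on_def by blast
  qed (simp add: w factors_on_def)
qed

lemma seg_in_factors: "seg \<xi> a b \<in> factors \<xi>"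
  unfolding factors_eq by auto

lemma factors_conv: "w \<in> factors \<xi> \<longleftrightarrow> (\<exists>a. seg \<xi> a (a + int (length w)) = w)"
proof
  assume "w \<in> factors \<xi>"
  then obtain a b where w: "w = seg \<xi> a b" by (auto simp: factors_eq)
  then have "w = seg \<xi> a (a + int (length w))"
    by (cases "a \<le> b") (auto simp: seg_def)
  then show "\<exists>a. seg \<xi> a (a + int (length w)) = w" by metis
next
  assume "\<exists>a. seg \<xi> a (a + int (length w)) = w"
  then show "w \<in> factors \<xi>" using seg_in_factors by metis
qed

lemma factors_append: "u @ v @ w \<in> factors \<xi> \<Longrightarrow> v \<in> factors \<xi>"
proof -
  assume "u @ v @ w \<in> factors \<xi>"
  then obtain a where a: "seg \<xi> a (a + int (length (u @ v @ w))) = u @ v @ w"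
    by (auto simp: factors_conv)
  have "seg \<xi> (a + int (length u)) (a + int (length u) + int (length v)) = v"
    unfolding seg_eq_iff
  proof (intro conjI allI impI)
    fix i assume "i < nat (a + int (length u) + int (length v) - (a + int (length u)))"
    then have i: "i < length v" by simp
    then have "(u @ v @ w) ! (length u + i) = \<xi> (a + int (length u + i))"
      by (subst a[symmetric], subst nth_seg) auto
    then show "v ! i = \<xi> (a + int (length u) + int i)"
      using i by (simp add: nth_append add_ac)
  qed simp
  then show ?thesis by (auto simp: factors_conv)
qed

lemma factors_on_atLeast: "w \<in> factors_on \<xi> {i..} \<longleftrightarrow> w = [] \<or> (\<exists>a\<ge>i. seg \<xi> a (a + int (length w)) = w)"
proof
  assume "w \<in> factors_on \<xi> {i..}"
  then consider "w = []" | a b where "a \<le> b" "i \<le> a" "w = seg \<xi> a (b + 1)"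
    by (auto simp: factors_on_def seg_def)
  then show "w = [] \<or> (\<exists>a\<ge>i. seg \<xi> a (a + int (length w)) = w)"
  proof cases
    case (2 a b)
    then show ?thesis by (intro disjI2 exI[of _ a]) simp
  qed simp
next
  assume "w = [] \<or> (\<exists>a\<ge>i. seg \<xi> a (a + int (length w)) = w)"
  moreover have "w \<in> factors_on \<xi> {i..}" if "w \<noteq> []" "a \<ge> i" "seg \<xi> a (a + int (length w)) = w" for a
  proof -
    have "w = map \<xi> [a..a + int (length w) - 1]" "a \<le> a + int (length w) - 1"
      using that by (auto simp: seg_def Suc_le_eq)
    then show ?thesis using that(2) unfolding factors_on_def by fastforce
  qed
  ultimately show "w \<in> factors_on \<xi> {i..}" by (auto simp: factors_on_def)
qed

lemma factors_on_atMost: "w \<in> factors_on \<xi> {..i} \<longleftrightarrow> w = [] \<or> (\<exists>a. a + int (length w) \<le> i + 1 \<and> seg \<xi> a (a + int (length w)) = w)"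
proof
  assume "w \<in> factors_on \<xi> {..i}"
  then consider "w = []" | a b where "a \<le> b" "b \<le> i" "w = seg \<xi> a (b + 1)"
    by (auto simp: factors_on_def seg_def)
  then show "w = [] \<or> (\<exists>a. a + int (length w) \<le> i + 1 \<and> seg \<xi> a (a + int (length w)) = w)"
  proof cases
    case (2 a b)
    then show ?thesis by (intro disjI2 exI[of _ a]) simp
  qed simp
next
  assume "w = [] \<or> (\<exists>a. a + int (length w) \<le> i + 1 \<and> seg \<xi> a (a + int (length w)) = w)"
  moreover have "w \<in> factors_on \<xi> {..i}"
    if "w \<noteq> []" "a + int (length w) \<le> i + 1" "seg \<xi> a (a + int (length w)) = w" for a
  proof -
    have "w = map \<xi> [a..a + int (length w) - 1]" "a \<le> a + int (length w) - 1"
      using that by (auto simp: seg_def Suc_le_eq)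
    then show ?thesis using that(2) unfolding factors_on_def by fastforce
  qed
  ultimately show "w \<in> factors_on \<xi> {..i}" by (auto simp: factors_on_def)
qed

lemma recurrent_conv:
  "recurrent \<xi> \<longleftrightarrow> (\<forall>w\<in>factors \<xi>. \<forall>i. (\<exists>a\<ge>i. seg \<xi> a (a + int (length w)) = w) \<and>
     (\<exists>a. a + int (length w) \<le> i \<and> seg \<xi> a (a + int (length w)) = w))" (is "_ \<longleftrightarrow> ?r")
proof
  assume rec: "recurrent \<xi>"
  show ?r
  proof (intro ballI allI)
    fix w i assume w: "w \<in> factors \<xi>"
    \<comment> \<open>\<open>factors_on_atMost\<close> bounds the exclusive end of an occurrence by
      one more than its argument, hence \<open>i - 1\<close>.\<close>
    have "w \<in> factors_on \<xi> {i..}" "w \<in> factors_on \<xi> {..i - 1}"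
      using rec w unfolding recurrent_def by blast+
    then show "(\<exists>a\<ge>i. seg \<xi> a (a + int (length w)) = w) \<and>
     (\<exists>a. a + int (length w) \<le> i \<and> seg \<xi> a (a + int (length w)) = w)"
      by (cases "w = []") (auto simp: factors_on_atLeast factors_on_atMost seg_def)
  qed
next
  assume r: ?r
  have sub: "factors_on \<xi> I \<subseteq> factors \<xi>" for I by (auto simp: factors_on_def)
  have "factors \<xi> \<subseteq> factors_on \<xi> {i..}" "factors \<xi> \<subseteq> factors_on \<xi> {..i}" for i
    using r unfolding factors_on_atLeast factors_on_atMost subset_iff by blast+
  then show "recurrent \<xi>" unfolding recurrent_def using sub by blast
qed

section \<open>Sparse sequences of positions and Ramsey's theorem\<close>

lemma unbounded_above_seq:
  fixes K :: "int set"
  assumes "\<And>i. \<exists>b\<ge>i. b \<in> K"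
  shows "\<exists>a :: nat \<Rightarrow> int. a 0 \<ge> k \<and> (\<forall>n. a n \<in> K \<and> a n + N \<le> a (Suc n))"
proof -
  have "\<exists>a. \<forall>n. (a n \<in> K \<and> (n = 0 \<longrightarrow> a n \<ge> k)) \<and> a n + N \<le> a (Suc n)"
  proof (rule dependent_nat_choice)
    show "\<exists>x. x \<in> K \<and> ((0::nat) = 0 \<longrightarrow> k \<le> x)" using assms[of k] by auto
    show "\<exists>y. (y \<in> K \<and> (Suc n = 0 \<longrightarrow> k \<le> y)) \<and> x + N \<le> y" for x n
      using assms[of "x + N"] by auto
  qed
  then show ?thesis by blast
qed

lemma unbounded_below_seq:
  fixes K :: "int set"
  assumes "\<And>i. \<exists>b\<le>i. b \<in> K"
  shows "\<exists>a :: nat \<Rightarrow> int. a 0 \<le> k \<and> (\<forall>n. a n \<in> K \<and> a (Suc n) + N \<le> a n)"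
proof -
  have "\<exists>b\<ge>i. b \<in> {b. - b \<in> K}" for i
  proof -
    obtain b where "b \<le> - i" "b \<in> K" using assms by blast
    then show ?thesis by (intro exI[of _ "- b"]) simp
  qed
  from unbounded_above_seq[OF this, of "- k" N] obtain a :: "nat \<Rightarrow> int"
    where a: "a 0 \<ge> - k" "\<And>n. - a n \<in> K" "\<And>n. a n + N \<le> a (Suc n)" by blast
  have "- a (Suc n) + N \<le> - a n" for n using a(3)[of n] by linarith
  with a(1,2) show ?thesis by (intro exI[of _ "\<lambda>n. - a n"]) simp
qed

lemma ramsey_subsequence:
  fixes col :: "nat \<Rightarrow> nat \<Rightarrow> nat"
  assumes "finite C" "\<And>i j. col i j \<in> C"
  shows "\<exists>(r :: nat \<Rightarrow> nat) c. strict_mono r \<and> (\<forall>i j. i < j \<longrightarrow> col (r i) (r j) = c)"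
proof -
  obtain s where s: "\<And>c. c \<in> C \<Longrightarrow> c < s"
    using finite_nat_set_iff_bounded[THEN iffD1, OF assms(1)] by blast
  \<comment> \<open>Ramsey's theorem colours unordered pairs; minimum and maximum restore the
    order.\<close>
  define f where "f X = col (Min X) (Max X)" for X
  have "f X < s" for X unfolding f_def by (rule s[OF assms(2)])
  then obtain Y c where Y: "infinite Y" "\<And>x y. x \<in> Y \<Longrightarrow> y \<in> Y \<Longrightarrow> x \<noteq> y \<Longrightarrow> f {x, y} = c"
    using Ramsey2[OF infinite_UNIV_nat, of f s] by auto
  have "col (enumerate Y i) (enumerate Y j) = c" if "i < j" for i j
  proof -
    have less: "enumerate Y i < enumerate Y j" using that Y(1) by (simp add: enumerate_mono)
    have "f {enumerate Y i, enumerate Y j} = c"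
      using less by (intro Y(2) enumerate_in_set Y(1)) auto
    moreover have "Min {enumerate Y i, enumerate Y j} = enumerate Y i"
      "Max {enumerate Y i, enumerate Y j} = enumerate Y j"
      using less by (simp_all add: min_def max_def)
    ultimately show ?thesis unfolding f_def by metis
  qed
  moreover have "strict_mono (enumerate Y)"
    using Y(1) by (simp add: strict_mono_def)
  ultimately show ?thesis by blast
qed

section \<open>Powers modulo a congruence of finite index\<close>

definition repeat :: "'a list \<Rightarrow> nat \<Rightarrow> 'a list" where
  "repeat x n = concat (replicate n x)"

lemma repeat_0 [simp]: "repeat x 0 = []"
  by (simp add: repeat_def)

lemma repeat_add: "repeat x (m + n) = repeat x m @ repeat x n"
  by (simp add: repeat_def replicate_add)

lemma repeat_Suc: "repeat x (Suc n) = x @ repeat x n" and repeat_Suc': "repeat x (Suc n) = repeat x n @ x"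
  using repeat_add[of x 1 n] repeat_add[of x n 1] by (simp_all add: repeat_def)

lemma congrD:
  assumes "congr h" "h u = h u'" "h v = h v'"
  shows "h (u @ v) = h (u' @ v')"
  using assms unfolding congr_def by blast

lemma congr_middle:
  assumes "congr h" "h v = h v'"
  shows "h (u @ v @ w) = h (u @ v' @ w)"
  using assms by (blast intro: congrD)

lemma repeat_cancel:
  assumes h: "congr h" and x: "h (x @ v @ y) = h v"
  shows "h (repeat x i @ v @ repeat y i) = h v"
proof (induction i)
  case (Suc i)
  have "h (repeat x i @ (x @ v @ y) @ repeat y i) = h (repeat x i @ v @ repeat y i)"
    by (rule congr_middle[OF h x])
  with Suc show ?case by (simp add: repeat_Suc[of y] repeat_Suc'[of x])
qed simp

lemma repeat_collision:
  assumes "congr h"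
  obtains i n where "h (repeat x (Suc n + i)) = h (repeat x i)"
proof -
  have "\<not> inj (\<lambda>i. h (repeat x i))"
  proof
    assume "inj (\<lambda>i. h (repeat x i))"
    moreover have "finite (range (\<lambda>i. h (repeat x i)))"
      using assms unfolding congr_def by (meson finite_subset image_subsetI rangeI)
    ultimately show False using finite_imageD by blast
  qed
  then obtain i j where "i \<noteq> j" "h (repeat x i) = h (repeat x j)" by (auto simp: inj_on_def)
  then obtain i j where "i < j" "h (repeat x i) = h (repeat x j)"
    by (metis nat_neq_iff)
  moreover from this obtain n where "j = Suc n + i"
    by (metis add.commute add_Suc_right less_imp_Suc_add)
  ultimately show thesis using that by metis
qed

text \<open>Stability of finite monoids: \<open>g = g v\<close> lies L-below \<open>v\<close> and,
  being J-equivalent to \<open>v\<close>, is L-equivalent to it. Modulo \<open>h\<close>, the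
  element \<open>x = v a g\<close> satisfies \<open>x v b = v\<close>, hence
  \<open>x^i v b^i = v\<close> for all \<open>i\<close>. A collision between powers of
  \<open>x\<close> turns this into \<open>v = x^(n+1) v = x^(n+1)\<close>, which ends in
  \<open>g\<close>.\<close>

lemma left_inverse:
  assumes h: "congr h" and vv: "h (v @ v) = h v" and gv: "h (g @ v) = h g"
    and agb: "h (a @ g @ b) = h v"
  shows "\<exists>l. h (l @ g) = h v"
proof -
  define x where "x = v @ a @ g"
  have xv: "h (x @ v) = h x"
    using congrD[OF h refl gv, of "v @ a"] by (simp add: x_def)
  have "h (x @ v @ b) = h (x @ b)"
    using congrD[OF h xv refl, of b] by simp
  also have "\<dots> = h (v @ v)"
    using congrD[OF h refl agb, of v] by (simp add: x_def)
  finally have xvb: "h (x @ v @ b) = h v" using vv by simp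
  obtain i n where in': "h (repeat x (Suc n + i)) = h (repeat x i)" by (rule repeat_collision[OF h])
  have "h v = h (repeat x (Suc n + i) @ v @ repeat b i)"
    using congrD[OF h in' refl, of "v @ repeat b i"] repeat_cancel[OF h xvb, of i] by simp
  also have "\<dots> = h (repeat x (Suc n) @ v)"
    using congrD[OF h refl repeat_cancel[OF h xvb, of i], of "repeat x (Suc n)"]
    by (simp only: repeat_add append_assoc)
  also have "\<dots> = h (repeat x n @ x)"
    using congrD[OF h refl xv, of "repeat x n"] by (simp add: repeat_Suc')
  finally show ?thesis unfolding x_def by (metis append_assoc)
qed

text \<open>Here \<open>s\<close> lies in the group with identity \<open>v\<close>. Modulo
  \<open>h\<close>, the left inverse gives \<open>l^i v s^i = v\<close>. If
  \<open>s^(n+1+i) = s^i\<close>, then also \<open>l^i v s^(i+n+1) = v\<close>, that is,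
  \<open>v s^(n+1) = v\<close>; and \<open>v\<close> is absorbed by \<open>s\<close>.\<close>

lemma power_trivial:
  assumes h: "congr h" and vv: "h (v @ v) = h v" and vs: "h (v @ s) = h s" and ls: "h (l @ s) = h v"
  shows "\<exists>n. h (repeat s (Suc n)) = h v"
proof -
  have lvs: "h (l @ v @ s) = h v" using congrD[OF h refl vs, of l] ls by simp
  obtain i n where in': "h (repeat s (Suc n + i)) = h (repeat s i)" by (rule repeat_collision[OF h])
  have "h v = h (repeat l i @ v @ repeat s (i + Suc n))"
    using congrD[OF h refl in', of "repeat l i @ v"] repeat_cancel[OF h lvs, of i] by (simp add: add_ac)
  also have "\<dots> = h (v @ repeat s (Suc n))"
    using congrD[OF h repeat_cancel[OF h lvs, of i] refl, of "repeat s (Suc n)"]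
    by (simp only: repeat_add append_assoc)
  also have "\<dots> = h (repeat s (Suc n))"
    using congrD[OF h vs refl, of "repeat s n"] by (simp add: repeat_Suc)
  finally show ?thesis by metis
qed

text \<open>The only idempotent of a group is its identity:
  \<open>g = v g = l g g = l g = v\<close>. The second factor is a word \<open>g'\<close> of its
  own, since adjacent blocks agree in their class but need not be equal.\<close>

lemma idempotent_trivial:
  assumes h: "congr h" and "h (l @ g) = h v" "h (g @ g') = h g" "h g' = h g" "h (v @ g) = h g"
  shows "h g = h v"
proof -
  have "h g = h (v @ g')" using assms congrD[OF h refl assms(4)] by metis
  also have "\<dots> = h (l @ g @ g')" using congrD[OF h assms(2) refl, of g'] by simp
  also have "\<dots> = h (l @ g)" using congrD[OF h refl assms(3)] by simp
  finally show ?thesis using assms(2) by simp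
qed

text \<open>\<open>J w\<close> below is the two-sided ideal generated by the class of \<open>w\<close>; minimising it over
  the factors means choosing the minimal \<open>\<J>\<close>-class met by the factors.\<close>

lemma minimal_idempotent:
  assumes h: "congr h" and rec: "recurrent \<xi>"
  obtains v v' where "v \<noteq> []" "v @ v' \<in> factors \<xi>" "h v' = h v" "h (v @ v') = h v"
    "\<And>p q. p @ v @ q \<in> factors \<xi> \<Longrightarrow> \<exists>a b. h (a @ p @ v @ q @ b) = h v"
proof -
  define J where "J w = {h (a @ w @ b) | a b. True}" for w
  have fin: "finite (range h)" using h by (simp add: congr_def)
  have finJ: "finite (J w)" for w
    by (rule finite_subset[OF _ fin]) (auto simp: J_def)
  have J_sub: "J (p @ w @ q) \<subseteq> J w" for p w q
  proof
    fix c assume "c \<in> J (p @ w @ q)"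
    then obtain a b where "c = h ((a @ p) @ w @ (q @ b))" by (auto simp: J_def)
    then show "c \<in> J w" unfolding J_def by blast
  qed
  obtain u where u: "u \<in> factors \<xi>" "\<And>w. w \<in> factors \<xi> \<Longrightarrow> card (J u) \<le> card (J w)"
    using ex_has_least_nat[of "\<lambda>w. w \<in> factors \<xi>" "[]" "\<lambda>w. card (J w)"] seg_in_factors[of \<xi> 0 0]
    by (auto simp: seg_def)
  have J_eq: "J (p @ u @ q) = J u" if "p @ u @ q \<in> factors \<xi>" for p q
    using card_subset_eq[OF finJ J_sub] card_mono[OF finJ J_sub] u(2)[OF that] by (metis le_antisym)
  let ?K = "{a. seg \<xi> a (a + int (length u)) = u}"
  have "\<exists>b\<ge>i. b \<in> ?K" for i using rec u(1) unfolding recurrent_conv by blast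
  \<comment> \<open>The extra 1 keeps the positions distinct even if \<open>u\<close> is
    empty.\<close>
  from unbounded_above_seq[of ?K 0 "int (length u) + 1", OF this] obtain a :: "nat \<Rightarrow> int"
    where a: "\<And>n. seg \<xi> (a n) (a n + int (length u)) = u"
      "\<And>n. a n + (int (length u) + 1) \<le> a (Suc n)" by blast
  \<comment> \<open>A common class for all pairs is idempotent. Since \<open>v @ v\<close> need not
    be a factor, the neighbouring block \<open>v'\<close> of the same class is kept as well.\<close>
  obtain r :: "nat \<Rightarrow> nat" and c where r: "strict_mono r"
      and c: "\<And>i j. i < j \<Longrightarrow> h (seg \<xi> (a (r i)) (a (r j))) = c"
    using ramsey_subsequence[OF fin, of "\<lambda>i j. h (seg \<xi> (a i) (a j))"] by blast
  have sm: "strict_mono a" unfolding strict_mono_Suc_iff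
  proof
    show "a n < a (Suc n)" for n using a(2)[of n] by linarith
  qed
  have lt: "a (r i) < a (r j)" if "i < j" for i j
    using that sm r by (simp add: strict_mono_def)
  define v where "v = seg \<xi> (a (r 0)) (a (r 1))"
  define v' where "v' = seg \<xi> (a (r 1)) (a (r 2))"
  have vv': "v @ v' = seg \<xi> (a (r 0)) (a (r 2))"
    using lt[of 0 1] lt[of 1 2] unfolding v_def v'_def by (intro seg_append) auto
  have ge: "a (r 0) + int (length u) \<le> a (r 1)"
  proof -
    have "Suc (r 0) \<le> r 1" using r by (simp add: strict_mono_def Suc_le_eq)
    then have "a (Suc (r 0)) \<le> a (r 1)" using sm by (simp add: strict_mono_less_eq)
    then show ?thesis using a(2)[of "r 0"] by simp
  qed
  define z where "z = seg \<xi> (a (r 0) + int (length u)) (a (r 1))"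
  have vz: "v = u @ z"
    using seg_append[of "a (r 0)" "a (r 0) + int (length u)" "a (r 1)" \<xi>] a(1)[of "r 0"] ge
    by (simp add: v_def z_def)
  show thesis
  proof
    show "v \<noteq> []" using lt[of 0 1] by (auto simp: v_def seg_def)
    show "v @ v' \<in> factors \<xi>" unfolding vv' by (rule seg_in_factors)
    show "h v' = h v" "h (v @ v') = h v"
      unfolding vv' using c[of 0 1] c[of 1 2] c[of 0 2] by (simp_all add: v_def v'_def)
    fix p q assume F: "p @ v @ q \<in> factors \<xi>"
    \<comment> \<open>\<open>v\<close> starts with \<open>u\<close>, so a factor around
      \<open>v\<close> extends \<open>u\<close>, and by minimality its ideal cannot be
      smaller.\<close>
    have "J (p @ v @ q) = J u" using J_eq[of p "z @ q"] F by (simp add: vz)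
    moreover have "h v = h ([] @ u @ z)" by (simp add: vz)
    then have "h v \<in> J u" unfolding J_def by blast
    ultimately have "h v \<in> J (p @ v @ q)" by simp
    then obtain a b where "h (a @ p @ v @ q @ b) = h v" by (auto simp: J_def)
    then show "\<exists>a b. h (a @ p @ v @ q @ b) = h v" by blast
  qed
qed

section \<open>Normal form of a recurrent word\<close>

lemma strict_mono_intI:
  fixes t :: "int \<Rightarrow> int"
  assumes "\<And>i. t i < t (i + 1)"
  shows "strict_mono t"
proof (rule strict_monoI)
  fix i j :: int assume "i < j"
  have "t i < t (i + 1 + int n)" for n
  proof (induction n)
    case (Suc n)
    have "t (i + 1 + int n) < t (i + 1 + int n + 1)" by (rule assms)
    with Suc show ?case by (simp add: add_ac)
  qed (simp add: assms)
  from this[of "nat (j - i - 1)"] show "t i < t j" using \<open>i < j\<close> by simp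
qed

lemma seg_repeat:
  fixes t :: "int \<Rightarrow> int"
  assumes t: "strict_mono t" and "\<And>j. k \<le> j \<Longrightarrow> j < k + int n \<Longrightarrow> seg x (t j) (t (j + 1)) = m"
  shows "seg x (t k) (t (k + int n)) = repeat m n"
  using assms(2)
proof (induction n)
  case (Suc n)
  have "seg x (t k) (t (k + int (Suc n))) =
      seg x (t k) (t (k + int n)) @ seg x (t (k + int n)) (t (k + int n + 1))"
    using strict_mono_less_eq[OF t] by (subst seg_append) (auto simp: add_ac)
  also have "\<dots> = repeat m n @ m"
    using Suc.IH Suc.prems by simp
  finally show ?case by (simp add: repeat_Suc')
qed (simp add: seg_def)

text \<open>A \<open>\<int>\<close>-word of type \<open>e\<^sup>\<omega>\<^sup>* s e\<^sup>\<omega>\<close> with \<open>s\<^sup>n = e\<close> is equivalent to \<open>s\<^sup>\<omega>\<^sup>* e\<^sup>\<omega>\<close>,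
  whose left half can be regrouped into blocks of type \<open>s\<^sup>n = e\<close>.\<close>

lemma absorb_middle:
  fixes A B :: "nat \<Rightarrow> int"
  assumes h: "congr h" and v: "v \<noteq> []"
    and A: "\<And>n. A n < A (Suc n)" "\<And>n. h (seg \<xi> (A n) (A (Suc n))) = h v"
    and B: "\<And>n. B (Suc n) < B n" "\<And>n. h (seg \<xi> (B (Suc n)) (B n)) = h v"
    and s: "B 0 < A 0" "h (repeat (seg \<xi> (B 0) (A 0)) (Suc n)) = h v"
  shows "\<exists>x (t :: int \<Rightarrow> int). blockwise_eq h \<xi> x \<and> strict_mono t \<and> (\<forall>i. h (seg x (t i) (t (i + 1))) = h v)"
proof -
  define m where "m = seg \<xi> (B 0) (A 0)"
  have m: "m \<noteq> []" using s(1) by (auto simp: m_def seg_def)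
  \<comment> \<open>\<open>x\<close> will consist of copies of \<open>m\<close> to the left of 0 and
    of copies of \<open>v\<close> from 0 on.\<close>
  define T where "T i = (if i < 0 then i * int (length m) else i * int (length v))" for i
  have T_step: "T (i + 1) - T i = int (length (if i < 0 then m else v))" for i
    by (cases "i = - 1") (auto simp: T_def algebra_simps)
  have T: "strict_mono T"
  proof (rule strict_mono_intI)
    have "length (if i < 0 then m else v) > 0" for i :: int using m v by simp
    then show "T i < T (i + 1)" for i using T_step[of i] by (metis diff_gt_0_iff_gt of_nat_0_less_iff)
  qed
  obtain x where x: "\<And>i. seg x (T i) (T (i + 1)) = (if i < 0 then m else v)"
    using glue[OF T, of "\<lambda>i. if i < 0 then m else v"] T_step by (metis nat_int)
  have repeat: "h (seg x (T k) (T l)) = h v" if "l = k + int (Suc n)" "l \<le> 0" for k l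
    using seg_repeat[OF T, of k "Suc n" x m] x s(2) that by (simp add: m_def)
  \<comment> \<open>Block 0 is the middle part, from \<open>B 0\<close> to
    \<open>A 0\<close>.\<close>
  define t where "t i = (if i \<le> 0 then B (nat (- i)) else A (nat (i - 1)))" for i
  \<comment> \<open>The shift by one copy of \<open>m\<close> leaves that copy alone as block 0,
    matching the middle part of \<xi>; the copies before it are grouped in runs of
    \<open>Suc n\<close>, which have class \<open>h v\<close>.\<close>
  define t' where "t' i = (if i \<le> 0 then T (int (Suc n) * i - 1) else T (i - 1))" for i
  \<comment> \<open>Without the shift no copy of \<open>m\<close> is left over, so every block has
    class \<open>h v\<close>.\<close>
  define t'' where "t'' i = (if i \<le> 0 then T (int (Suc n) * i) else T i)" for i
  have "i < 0 \<or> i = 0 \<or> i > 0" for i :: int by linarith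
  note cases3 = this
  have t_neg: "t i = B (Suc (nat (- i - 1)))" "t (i + 1) = B (nat (- i - 1))" if "i < 0" for i
    using that by (auto simp: t_def nat_diff_distrib Suc_nat_eq_nat_zadd1)
  have t_pos: "t i = A (nat (i - 1))" "t (i + 1) = A (Suc (nat (i - 1)))" if "i > 0" for i
    using that by (auto simp: t_def nat_diff_distrib Suc_nat_eq_nat_zadd1)
  have t_0: "t 0 = B 0" "t 1 = A 0" by (auto simp: t_def)
  have "t i < t (i + 1)" for i
    using cases3[of i] t_neg[of i] t_pos[of i] A(1) B(1) s(1) t_0 by auto
  then have t: "strict_mono t" by (rule strict_mono_intI)
  have t'_neg: "t' i = T (int (Suc n) * i - 1)" "t' (i + 1) = T (int (Suc n) * i - 1 + int (Suc n))" if "i < 0" for i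
    using that by (simp_all add: t'_def algebra_simps)
  have t''_neg: "t'' i = T (int (Suc n) * i)" "t'' (i + 1) = T (int (Suc n) * i + int (Suc n))" if "i < 0" for i
    using that by (simp_all add: t''_def algebra_simps)
  have "t' i < t' (i + 1)" for i
    using cases3[of i] t'_neg[of i] by (auto simp: t'_def strict_mono_less[OF T])
  then have t': "strict_mono t'" by (rule strict_mono_intI)
  have "t'' i < t'' (i + 1)" for i
    using cases3[of i] t''_neg[of i] by (auto simp: t''_def strict_mono_less[OF T])
  then have t'': "strict_mono t''" by (rule strict_mono_intI)
  have neg: "int (Suc n) * i + int (Suc n) \<le> 0" if "i < 0" for i
  proof -
    have "int (Suc n) * (i + 1) \<le> 0" using that by (intro mult_nonneg_nonpos) auto
    then show ?thesis by (simp add: algebra_simps)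
  qed
  have "h (seg \<xi> (t i) (t (i + 1))) = h (seg x (t' i) (t' (i + 1)))" for i
  proof (cases i "0 :: int" rule: linorder_cases)
    case less
    have "h (seg x (t' i) (t' (i + 1))) = h v"
      unfolding t'_neg[OF less] by (rule repeat) (use neg[OF less] in auto)
    moreover have "h (seg \<xi> (t i) (t (i + 1))) = h v"
      unfolding t_neg[OF less] by (rule B(2))
    ultimately show ?thesis by simp
  next
    case equal
    then show ?thesis using x[of "- 1"] by (simp add: t_0 t'_def m_def)
  next
    case greater
    then have "h (seg x (t' i) (t' (i + 1))) = h v" using x[of "i - 1"] by (simp add: t'_def)
    moreover have "h (seg \<xi> (t i) (t (i + 1))) = h v"
      unfolding t_pos[OF greater] by (rule A(2))
    ultimately show ?thesis by simp
  qed
  then have "blockwise_eq h \<xi> x" unfolding blockwise_eq_def using t t' by blast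
  moreover have "h (seg x (t'' i) (t'' (i + 1))) = h v" for i
  proof (cases "i < 0")
    case True
    show ?thesis
      unfolding t''_neg[OF True] by (rule repeat) (use neg[OF True] in auto)
  next
    case False
    then show ?thesis using x[of i] by (cases "i = 0") (auto simp: t''_def)
  qed
  ultimately show ?thesis using t'' by blast
qed

text \<open>A border in \<open>K\<close> separates an occurrence of \<open>v\<close> from one of
  \<open>v'\<close>. A long segment between borders begins with \<open>v'\<close> and ends with
  \<open>v\<close>, so \<open>v\<close> acts on it as an identity from both sides, and minimality
  puts it into the group of \<open>v\<close>. Blocks obtained from Ramsey's theorem are idempotent,
  hence of class \<open>h v\<close>; only a middle segment remains, and some power of it has this
  class too.\<close>

lemma recurrent_normal_form:
  assumes h: "congr h" and rec: "recurrent \<xi>"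
    and v: "v \<noteq> []" "v @ v' \<in> factors \<xi>" "h v' = h v" "h (v @ v') = h v"
      "\<And>p q. p @ v @ q \<in> factors \<xi> \<Longrightarrow> \<exists>a b. h (a @ p @ v @ q @ b) = h v"
  shows "\<exists>x (t :: int \<Rightarrow> int). blockwise_eq h \<xi> x \<and> strict_mono t \<and> (\<forall>i. h (seg x (t i) (t (i + 1))) = h v)"
proof -
  define K where "K = {p. seg \<xi> (p - int (length v)) (p + int (length v')) = v @ v'}"
  \<comment> \<open>At this distance, the \<open>v'\<close> after the first border and the
    \<open>v\<close> before the second do not overlap.\<close>
  define N where "N = int (length v) + int (length v')"
  have N: "N > 0" using v(1) by (cases v) (simp_all add: N_def)
  have vv: "h (v @ v) = h v" using congrD[OF h refl v(3), of v] v(4) by simp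
  have shift: "a + int (length v) \<in> K" if "seg \<xi> a (a + int (length (v @ v'))) = v @ v'" for a
    using that by (simp add: K_def add_ac)
  have above: "\<exists>b\<ge>i. b \<in> K" for i
  proof -
    obtain a where "a \<ge> i" "seg \<xi> a (a + int (length (v @ v'))) = v @ v'"
      using rec v(2) unfolding recurrent_conv by blast
    then show ?thesis using shift by (intro exI[of _ "a + int (length v)"]) auto
  qed
  have below: "\<exists>b\<le>i. b \<in> K" for i
  proof -
    obtain a where "a + int (length (v @ v')) \<le> i" "seg \<xi> a (a + int (length (v @ v'))) = v @ v'"
      using rec v(2) unfolding recurrent_conv by blast
    then show ?thesis using shift by (intro exI[of _ "a + int (length v)"]) auto
  qed
  have ends: "seg \<xi> (p - int (length v)) p = v" "seg \<xi> p (p + int (length v')) = v'" if "p \<in> K" for p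
    using that seg_append[of "p - int (length v)" p "p + int (length v')" \<xi>]
    by (auto simp: K_def append_eq_append_conv)
  have block: "h (v @ seg \<xi> p q) = h (seg \<xi> p q) \<and> (\<exists>l. h (l @ seg \<xi> p q) = h v)"
    if pq: "p \<in> K" "q \<in> K" "p + N \<le> q" for p q
  proof -
    define y where "y = seg \<xi> (p + int (length v')) (q - int (length v))"
    have g: "seg \<xi> p q = v' @ y @ v"
      using seg_append[of p "p + int (length v')" q \<xi>] ends[OF pq(1)] ends[OF pq(2)] pq(3)
        seg_append[of "p + int (length v')" "q - int (length v)" q \<xi>]
      by (simp add: y_def N_def)
    have "h (v @ v' @ y @ v) = h (v' @ y @ v)"
      using congrD[OF h _ refl, of "v @ v'" v' "y @ v"] v(3,4) by simp
    moreover have "h ((v' @ y @ v) @ v) = h (v' @ y @ v)"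
      using congrD[OF h refl vv, of "v' @ y"] by simp
    moreover have "(v' @ y) @ v @ [] \<in> factors \<xi>"
      using seg_in_factors[of \<xi> p q] unfolding g by simp
    then obtain a b where "h (a @ (v' @ y) @ v @ [] @ b) = h v" using v(5) by blast
    then have "h (a @ (v' @ y @ v) @ b) = h v" by simp
    ultimately show ?thesis unfolding g using left_inverse[OF h vv] by blast
  qed
  have fin: "finite (range h)" using h by (simp add: congr_def)
  obtain a where a: "a 0 \<ge> 0" "\<And>n. a n \<in> K" "\<And>n. a n + N \<le> a (Suc n)"
    using unbounded_above_seq[OF above] by blast
  \<comment> \<open>The bound \<open>- N\<close> makes the segment across the origin long enough for
    \<open>block\<close> as well.\<close>
  obtain b where b: "b 0 \<le> - N" "\<And>n. b n \<in> K" "\<And>n. b (Suc n) + N \<le> b n"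
    using unbounded_below_seq[OF below] by blast
  have a_mono: "a i + N \<le> a j" if "i < j" for i j :: nat
    using that
  proof (induction j)
    case (Suc j)
    then show ?case using a(3)[of j] N by (cases "i = j") auto
  qed simp
  have b_mono: "b j + N \<le> b i" if "i < j" for i j :: nat
    using that
  proof (induction j)
    case (Suc j)
    then show ?case using b(3)[of j] N by (cases "i = j") auto
  qed simp
  obtain r :: "nat \<Rightarrow> nat" and c where r: "strict_mono r" "\<And>i j. i < j \<Longrightarrow> h (seg \<xi> (a (r i)) (a (r j))) = c"
    using ramsey_subsequence[OF fin, of "\<lambda>i j. h (seg \<xi> (a i) (a j))"] by blast
  obtain r' :: "nat \<Rightarrow> nat" and c' where r': "strict_mono r'" "\<And>i j. i < j \<Longrightarrow> h (seg \<xi> (b (r' j)) (b (r' i))) = c'"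
    using ramsey_subsequence[OF fin, of "\<lambda>i j. h (seg \<xi> (b j) (b i))"] by blast
  have r_less: "r i < r j" "r' i < r' j" if "i < j" for i j
    using that r(1) r'(1) by (auto simp: strict_mono_def)
  have trivial: "h (seg \<xi> p q) = h v"
    if pq: "p \<in> K" "q \<in> K" "p + N \<le> q" "q + N \<le> z" "h (seg \<xi> p q) = d" "h (seg \<xi> q z) = d" "h (seg \<xi> p z) = d"
    for p q z d
  proof -
    obtain l where l: "h (l @ seg \<xi> p q) = h v" "h (v @ seg \<xi> p q) = h (seg \<xi> p q)"
      using block pq(1-3) by blast
    have "seg \<xi> p q @ seg \<xi> q z = seg \<xi> p z" using pq N by (intro seg_append) auto
    then show ?thesis using idempotent_trivial[OF h l(1) _ _ l(2), of "seg \<xi> q z"] pq by simp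
  qed
  have c: "c = h v"
    using trivial[of "a (r 0)" "a (r 1)" "a (r 2)" c] a(2) a_mono r_less(1) r(2) by simp
  have c': "c' = h v"
    using trivial[of "b (r' 2)" "b (r' 1)" "b (r' 0)" c'] b(2) b_mono r_less(2) r'(2) by simp
  have "b (r' 0) \<le> b 0" "a 0 \<le> a (r 0)"
    using a_mono[of 0 "r 0"] b_mono[of 0 "r' 0"] N by (cases "r 0 = 0"; cases "r' 0 = 0"; simp)+
  then have ba: "b (r' 0) + N \<le> a (r 0)" using a(1) b(1) by simp
  obtain n where n: "h (repeat (seg \<xi> (b (r' 0)) (a (r 0))) (Suc n)) = h v"
    using block[OF b(2) a(2) ba] power_trivial[OF h vv] by blast
  show ?thesis
  proof (rule absorb_middle[OF h v(1), of "\<lambda>n. a (r n)" \<xi> "\<lambda>n. b (r' n)"])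
    show "a (r i) < a (r (Suc i))" "b (r' (Suc i)) < b (r' i)" for i
      using a_mono[OF r_less(1), of i "Suc i"] b_mono[OF r_less(2), of i "Suc i"] N by auto
    show "h (seg \<xi> (a (r i)) (a (r (Suc i)))) = h v" "h (seg \<xi> (b (r' (Suc i))) (b (r' i))) = h v" for i
      using r(2)[of i "Suc i"] r'(2)[of i "Suc i"] c c' by auto
    show "b (r' 0) < a (r 0)" using ba N by simp
    show "h (repeat (seg \<xi> (b (r' 0)) (a (r 0))) (Suc n)) = h v" by (rule n)
  qed
qed

theorem MTh_eq_of_factors_eq:
  assumes "recurrent \<xi>" "recurrent \<eta>" "factors \<xi> = factors \<eta>"
  shows "MTh \<xi> = MTh \<eta>"
proof -
  have "\<phi> \<in> MTh \<eta>"
    if F: "recurrent \<xi>" "recurrent \<eta>" "factors \<xi> = factors \<eta>" and \<phi>: "\<phi> \<in> MTh \<xi>" for \<xi> \<eta> \<phi>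
  proof -
    have "sentence \<phi>" and sat: "\<forall>e E. sat (\<le>) (\<xi> -` {True}) e E \<phi>" using \<phi> by (auto simp: MTh_def)
    then obtain h :: "bool list \<Rightarrow> nat" where h: "congr h" and
      step: "\<And>\<xi> \<eta>. blockwise_eq h \<xi> \<eta> \<Longrightarrow> \<forall>e E. sat (\<le>) (\<xi> -` {True}) e E \<phi> \<Longrightarrow>
        \<forall>e E. sat (\<le>) (\<eta> -` {True}) e E \<phi>"
      using sentence_recognisable by metis
    obtain v v' where v: "v \<noteq> []" "v @ v' \<in> factors \<xi>" "h v' = h v" "h (v @ v') = h v"
      "\<And>p q. p @ v @ q \<in> factors \<xi> \<Longrightarrow> \<exists>a b. h (a @ p @ v @ q @ b) = h v"
      using minimal_idempotent[OF h F(1)] by blast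
    obtain x and t :: "int \<Rightarrow> int" where x: "blockwise_eq h \<xi> x" "strict_mono t" "\<And>i. h (seg x (t i) (t (i + 1))) = h v"
      using recurrent_normal_form[OF h F(1) v] by blast
    \<comment> \<open>The same \<open>v\<close> qualifies for \<eta>, as the conditions on it
      mention \<xi> only through its factors.\<close>
    obtain y and u :: "int \<Rightarrow> int" where y: "blockwise_eq h \<eta> y" "strict_mono u" "\<And>i. h (seg y (u i) (u (i + 1))) = h v"
      using recurrent_normal_form[OF h F(2) v[unfolded F(3)]] by blast
    have "blockwise_eq h x y" unfolding blockwise_eq_def using x y by metis
    then have "\<forall>e E. sat (\<le>) (\<eta> -` {True}) e E \<phi>"
      using step[OF x(1) sat] step step[OF blockwise_eq_sym[OF y(1)]] by blast
    then show ?thesis using \<open>sentence \<phi>\<close> by (simp add: MTh_def)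
  qed
  then show ?thesis using assms by blast
qed

section \<open>Relative computability\<close>

text \<open>Arguments are read off an infinite environment of which only a finite prefix matters; a
  bound variable is pushed in front of the environment.\<close>

definition computable :: "nat set \<Rightarrow> ((nat \<Rightarrow> nat) \<Rightarrow> nat) \<Rightarrow> bool" where
  "computable B F \<longleftrightarrow> (\<exists>k p. \<forall>m\<ge>k. \<forall>e. computes B p (map e [0..<m]) (F e))"

abbreviation decidable :: "nat set \<Rightarrow> ((nat \<Rightarrow> nat) \<Rightarrow> bool) \<Rightarrow> bool" where
  "decidable B P \<equiv> computable B (\<lambda>e. of_bool (P e))"

lemma computable_var: "computable B (\<lambda>e. e i)"
proof -
  have "computes B (PProj i) (map e [0..<m]) (e i)" if "m \<ge> Suc i" for m e
    using computes.proj[of i "map e [0..<m]" B] that by simp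
  then show ?thesis unfolding computable_def by blast
qed

lemma computable_zero: "computable B (\<lambda>e. 0)"
  unfolding computable_def using computes.zero by blast

lemma computable_unary:
  assumes "\<And>n. computes B p [n] (f n)" and "computable B F"
  shows "computable B (\<lambda>e. f (F e))"
proof -
  obtain k q where q: "\<And>m e. m \<ge> k \<Longrightarrow> computes B q (map e [0..<m]) (F e)"
    using assms(2) unfolding computable_def by blast
  have "computes B (PComp p [q]) (map e [0..<m]) (f (F e))" if "m \<ge> k" for m e
    by (rule computes.comp[of _ _ _ "[F e]"]) (simp_all add: q[OF that] assms(1))
  then show ?thesis unfolding computable_def by blast
qed

lemma computable_Suc: "computable B F \<Longrightarrow> computable B (\<lambda>e. Suc (F e))"
  by (rule computable_unary[OF computes.succ])

lemma computable_const: "computable B (\<lambda>e. c)"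
  by (induction c) (auto intro: computable_zero computable_Suc)

lemma computable_subst:
  assumes "computable B H" and "\<And>i. computable B (\<lambda>e. \<sigma> e i)"
  shows "computable B (\<lambda>e. H (\<sigma> e))"
proof -
  obtain k p where p: "\<And>m e. m \<ge> k \<Longrightarrow> computes B p (map e [0..<m]) (H e)"
    using assms(1) unfolding computable_def by blast
  have "\<forall>i. \<exists>k p. \<forall>m\<ge>k. \<forall>e. computes B p (map e [0..<m]) (\<sigma> e i)"
    using assms(2) unfolding computable_def by blast
  then obtain l q where q: "\<And>i m e. m \<ge> l i \<Longrightarrow> computes B (q i) (map e [0..<m]) (\<sigma> e i)"
    by metis
  have "computes B (PComp p (map q [0..<k])) (map e [0..<m]) (H (\<sigma> e))"
    if m: "m \<ge> (\<Sum>i<k. l i)" for m e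
  proof (rule computes.comp)
    have "l i \<le> m" if "i < k" for i
      using m member_le_sum[of i "{..<k}" l] that by simp
    then show "list_all2 (\<lambda>r y. computes B r (map e [0..<m]) y) (map q [0..<k]) (map (\<sigma> e) [0..<k])"
      by (simp add: list_all2_conv_all_nth q)
    show "computes B p (map (\<sigma> e) [0..<k]) (H (\<sigma> e))" by (rule p) simp
  qed
  then show ?thesis unfolding computable_def by blast
qed

lemma computable_shift: "computable B F \<Longrightarrow> computable B (\<lambda>e. F (\<lambda>i. e (Suc i)))"
  by (erule computable_subst) (rule computable_var)

lemma computable_shift2: "computable B F \<Longrightarrow> computable B (\<lambda>e. F (\<lambda>i. e (Suc (Suc i))))"
  by (erule computable_subst) (rule computable_var)

lemma map_case_nat: "map (case_nat x e) [0..<Suc m] = x # map e [0..<m]"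
  by (simp add: upt_conv_Cons map_Suc_upt[symmetric] del: upt_Suc)

text \<open>\<open>step\<close> takes the counter, the previous value and the parameters in the
  order in which \<open>PRec\<close> supplies them.\<close>

lemma computable_rec:
  assumes "computable B base" and "computable B (\<lambda>e. step (e 0) (e (Suc 0)) (\<lambda>i. e (Suc (Suc i))))" and "computable B N"
  shows "computable B (\<lambda>e. rec_nat (base e) (\<lambda>n r. step n r e) (N e))"
proof -
  obtain k1 p where p: "\<And>m e. m \<ge> k1 \<Longrightarrow> computes B p (map e [0..<m]) (base e)"
    using assms(1) unfolding computable_def by blast
  obtain k2 q where q: "\<And>m e. m \<ge> k2 \<Longrightarrow>
      computes B q (map e [0..<m]) (step (e 0) (e (Suc 0)) (\<lambda>i. e (Suc (Suc i))))"
    using assms(2) unfolding computable_def by blast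
  obtain k3 r where r: "\<And>m e. m \<ge> k3 \<Longrightarrow> computes B r (map e [0..<m]) (N e)"
    using assms(3) unfolding computable_def by blast
  define k where "k = k1 + k2"
  have R: "computes B (PRec p q) (n # map e [0..<k]) (rec_nat (base e) (\<lambda>n r. step n r e) n)" for n e
  proof (induction n)
    case 0
    show ?case using p[of k e] by (auto simp: k_def intro: computes.rec_0)
  next
    case (Suc n)
    let ?y = "rec_nat (base e) (\<lambda>n r. step n r e) n"
    have "computes B q (n # ?y # map e [0..<k]) (step n ?y e)"
      using q[of "Suc (Suc k)" "case_nat n (case_nat ?y e)"] unfolding map_case_nat
      by (simp add: k_def)
    with Suc show ?case by (auto intro: computes.rec_Suc)
  qed
  \<comment> \<open>The projections cut the environment down to the prefix of length
    \<open>k\<close> on which the recursion runs.\<close>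
  have "computes B (PComp (PRec p q) (r # map PProj [0..<k])) (map e [0..<m])
      (rec_nat (base e) (\<lambda>n r. step n r e) (N e))" if m: "m \<ge> k + k3" for m e
  proof (rule computes.comp)
    have "computes B (PProj i) (map e [0..<m]) (e i)" if "i < k" for i
      using computes.proj[of i "map e [0..<m]" B] that m by simp
    then show "list_all2 (\<lambda>r y. computes B r (map e [0..<m]) y)
        (r # map PProj [0..<k]) (N e # map e [0..<k])"
      using m by (simp add: r list_all2_map1 list_all2_map2 list_all2_same)
    show "computes B (PRec p q) (N e # map e [0..<k]) (rec_nat (base e) (\<lambda>n r. step n r e) (N e))"
      by (rule R)
  qed
  then show ?thesis unfolding computable_def by blast
qed

lemma computable_Least_zero:
  assumes "computable B (\<lambda>e. G (e 0) (\<lambda>i. e (Suc i)))" and ex: "\<And>e. \<exists>n. G n e = 0"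
  shows "computable B (\<lambda>e. LEAST n. G n e = 0)"
proof -
  obtain k p where p: "\<And>m e. m \<ge> k \<Longrightarrow> computes B p (map e [0..<m]) (G (e 0) (\<lambda>i. e (Suc i)))"
    using assms(1) unfolding computable_def by blast
  have "computes B (PMin p) (map e [0..<m]) (LEAST n. G n e = 0)" if m: "m \<ge> k" for m e
  proof (rule computes.min)
    have c: "computes B p (n # map e [0..<m]) (G n e)" for n
      using p[of "Suc m" "case_nat n e"] m unfolding map_case_nat by simp
    have "G (LEAST n. G n e = 0) e = 0" using ex[of e] by (rule LeastI_ex)
    then show "computes B p ((LEAST n. G n e = 0) # map e [0..<m]) 0"
      using c[of "LEAST n. G n e = 0"] by simp
    show "\<exists>y>0. computes B p (n # map e [0..<m]) y" if "n < (LEAST n. G n e = 0)" for n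
      using c[of n] not_less_Least[OF that] by (intro exI[of _ "G n e"]) simp
  qed
  then show ?thesis unfolding computable_def by blast
qed

section \<open>Arithmetic, connectives, bounded quantifiers and pairing\<close>

lemma computable_pred: "computable B F \<Longrightarrow> computable B (\<lambda>e. F e - 1)"
proof -
  assume F: "computable B F"
  have "rec_nat 0 (\<lambda>n r. n) m = m - 1" for m :: nat by (cases m) auto
  moreover have "computable B (\<lambda>e. rec_nat 0 (\<lambda>n r. n) (F e))"
    by (intro computable_rec computable_const computable_var F)
  ultimately show ?thesis by simp
qed

lemma computable_plus: "computable B F \<Longrightarrow> computable B G \<Longrightarrow> computable B (\<lambda>e. F e + G e)"
proof -
  assume F: "computable B F" and G: "computable B G"
  have "rec_nat k (\<lambda>n r. Suc r) m = k + m" for k m :: nat by (induction m) auto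
  moreover have "computable B (\<lambda>e. rec_nat (F e) (\<lambda>n r. Suc r) (G e))"
    by (intro computable_rec computable_Suc computable_var F G)
  ultimately show ?thesis by simp
qed

lemma computable_minus: "computable B F \<Longrightarrow> computable B G \<Longrightarrow> computable B (\<lambda>e. F e - G e)"
proof -
  assume F: "computable B F" and G: "computable B G"
  have "rec_nat k (\<lambda>n r. r - 1) m = k - m" for k m :: nat by (induction m) auto
  moreover have "computable B (\<lambda>e. rec_nat (F e) (\<lambda>n r. r - 1) (G e))"
    by (intro computable_rec computable_pred computable_var F G)
  ultimately show ?thesis by simp
qed

lemma computable_times: "computable B F \<Longrightarrow> computable B G \<Longrightarrow> computable B (\<lambda>e. F e * G e)"
proof -
  assume F: "computable B F" and G: "computable B G"
  have "rec_nat 0 (\<lambda>n r. r + k) m = k * m" for k m :: nat by (induction m) auto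
  moreover have "computable B (\<lambda>e. rec_nat 0 (\<lambda>n r. r + F e) (G e))"
    by (intro computable_rec[where step = "\<lambda>n r e. r + F e"] computable_plus computable_var computable_const computable_shift2 F G)
  ultimately show ?thesis by simp
qed

lemma computable_not: "decidable B P \<Longrightarrow> decidable B (\<lambda>e. \<not> P e)"
proof -
  assume P: "decidable B P"
  have "computable B (\<lambda>e. 1 - of_bool (P e))" by (intro computable_minus computable_const P)
  moreover have "1 - of_bool b = (of_bool (\<not> b) :: nat)" for b by simp
  ultimately show ?thesis by (simp only:)
qed

lemma computable_conj: "decidable B P \<Longrightarrow> decidable B Q \<Longrightarrow> decidable B (\<lambda>e. P e \<and> Q e)"
  by (drule (1) computable_times) (simp add: of_bool_conj)

lemma computable_disj: "decidable B P \<Longrightarrow> decidable B Q \<Longrightarrow> decidable B (\<lambda>e. P e \<or> Q e)"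
  using computable_not[OF computable_conj[OF computable_not computable_not], of B P Q] by simp

lemma computable_iff: "decidable B P \<Longrightarrow> decidable B Q \<Longrightarrow> decidable B (\<lambda>e. P e \<longleftrightarrow> Q e)"
proof -
  assume "decidable B P" "decidable B Q"
  then have "decidable B (\<lambda>e. P e \<and> Q e \<or> \<not> P e \<and> \<not> Q e)"
    by (intro computable_disj computable_conj computable_not)
  moreover have "a \<and> b \<or> \<not> a \<and> \<not> b \<longleftrightarrow> (a \<longleftrightarrow> b)" for a b by blast
  ultimately show ?thesis by (simp only:)
qed

lemma computable_le: "computable B F \<Longrightarrow> computable B G \<Longrightarrow> decidable B (\<lambda>e. F e \<le> G e)"
proof -
  assume "computable B F" "computable B G"
  then have "computable B (\<lambda>e. 1 - (F e - G e))" by (intro computable_minus computable_const)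
  moreover have "1 - (a - b) = of_bool (a \<le> b)" for a b :: nat by auto
  ultimately show ?thesis by simp
qed

lemma computable_less: "computable B F \<Longrightarrow> computable B G \<Longrightarrow> decidable B (\<lambda>e. F e < G e)"
  using computable_le[OF computable_Suc, of B F G] by (simp add: Suc_le_eq)

lemma computable_eq: "computable B F \<Longrightarrow> computable B G \<Longrightarrow> decidable B (\<lambda>e. F e = G e)"
  using computable_conj[OF computable_le computable_le, of B F G G F] by (simp add: order_eq_iff)

lemma computable_if: "decidable B P \<Longrightarrow> computable B F \<Longrightarrow> computable B G \<Longrightarrow> computable B (\<lambda>e. if P e then F e else G e)"
proof -
  assume "decidable B P" "computable B F" "computable B G"
  then have "computable B (\<lambda>e. of_bool (P e) * F e + of_bool (\<not> P e) * G e)"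
    by (intro computable_plus computable_times computable_not)
  moreover have "of_bool b * x + of_bool (\<not> b) * y = (if b then x else y)" for b and x y :: nat
    by simp
  ultimately show ?thesis by simp
qed

lemma computable_all:
  assumes P: "decidable B (\<lambda>e. P (e 0) (\<lambda>i. e (Suc i)))" and N: "computable B N"
  shows "decidable B (\<lambda>e. \<forall>i<N e. P i e)"
proof -
  have "rec_nat (1 :: nat) (\<lambda>n r. r * of_bool (Q n)) m = of_bool (\<forall>i<m. Q i)" for Q and m :: nat
    by (induction m) (auto simp: less_Suc_eq)
  moreover have "computable B (\<lambda>e. rec_nat 1 (\<lambda>n r. r * of_bool (P n e)) (N e))"
  proof (rule computable_rec[where step = "\<lambda>n r e. r * of_bool (P n e)"])
    \<comment> \<open>In the recursion the accumulator stands between the counter and the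
      parameters; this substitution skips it.\<close>
    have "computable B (\<lambda>e. case_nat (e 0) (\<lambda>i. e (Suc (Suc i))) i)" for i
      by (cases i) (simp_all add: computable_var)
    from computable_subst[OF P, of "\<lambda>e. case_nat (e 0) (\<lambda>i. e (Suc (Suc i)))", OF this] have "computable B (\<lambda>e. of_bool (P (e 0) (\<lambda>i. e (Suc (Suc i)))))" by simp
    then show "computable B (\<lambda>e. e (Suc 0) * of_bool (P (e 0) (\<lambda>i. e (Suc (Suc i)))))"
      by (intro computable_times computable_var)
  qed (intro computable_const N)+
  ultimately show ?thesis by (simp only:)
qed

lemma computable_ex:
  assumes "decidable B (\<lambda>e. P (e 0) (\<lambda>i. e (Suc i)))" and "computable B N"
  shows "decidable B (\<lambda>e. \<exists>i<N e. P i e)"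
  using computable_not[OF computable_all[OF computable_not[OF assms(1)] assms(2)]] by simp

lemma computable_Least:
  assumes P: "decidable B (\<lambda>e. P (e 0) (\<lambda>i. e (Suc i)))" and ex: "\<And>e. \<exists>n. P n e"
  shows "computable B (\<lambda>e. LEAST n. P n e)"
proof -
  have "computable B (\<lambda>e. LEAST n. (of_bool (\<not> P n e) :: nat) = 0)"
    by (rule computable_Least_zero) (use computable_not[OF P] ex in auto)
  then show ?thesis by simp
qed

lemma computable_pow2: "computable B F \<Longrightarrow> computable B (\<lambda>e. 2 ^ F e)"
proof -
  assume F: "computable B F"
  have "rec_nat 1 (\<lambda>n r. r + r) m = (2 :: nat) ^ m" for m by (induction m) auto
  moreover have "computable B (\<lambda>e. rec_nat 1 (\<lambda>n r. r + r) (F e))"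
    by (intro computable_rec computable_const computable_plus computable_var F)
  ultimately show ?thesis by simp
qed

lemma computable_div_pow2: "computable B F \<Longrightarrow> computable B G \<Longrightarrow> computable B (\<lambda>e. F e div 2 ^ G e)"
proof -
  assume F: "computable B F" and G: "computable B G"
  have *: "a < Suc q * 2 ^ b \<longleftrightarrow> a div 2 ^ b \<le> q" for a b q :: nat
    by (simp add: less_Suc_eq_le[symmetric] div_less_iff_less_mult del: mult_Suc)
  have "computable B (\<lambda>e. LEAST q. F e < Suc q * 2 ^ G e)"
    by (rule computable_Least, intro computable_less computable_times computable_Suc computable_pow2 computable_var computable_shift F G)
      (use * in blast)
  moreover have "(LEAST q. a < Suc q * 2 ^ b) = a div 2 ^ b" for a b :: nat
    unfolding * by (rule Least_equality) auto
  ultimately show ?thesis by simp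
qed

lemma computable_odd: "computable B F \<Longrightarrow> decidable B (\<lambda>e. odd (F e))"
proof -
  assume "computable B F"
  then have "decidable B (\<lambda>e. \<not> F e = 2 * (F e div 2 ^ 1))"
    by (intro computable_not computable_eq computable_times computable_div_pow2 computable_const)
  moreover have "\<not> a = 2 * (a div 2 ^ 1) \<longleftrightarrow> odd a" for a :: nat
    by (metis dvd_triv_left even_two_times_div_two power_one_right)
  ultimately show ?thesis by (simp only:)
qed

lemma computable_prod_encode: "computable B F \<Longrightarrow> computable B G \<Longrightarrow> computable B (\<lambda>e. prod_encode (F e, G e))"
proof -
  assume F: "computable B F" and G: "computable B G"
  have *: "triangle m = rec_nat 0 (\<lambda>n r. r + Suc n) m" for m
    by (induction m) auto
  show ?thesis unfolding prod_encode_def prod.case *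
    by (intro computable_plus computable_rec computable_const computable_Suc computable_var F G)
qed

definition pfst :: "nat \<Rightarrow> nat" where "pfst z = fst (prod_decode z)"
definition psnd :: "nat \<Rightarrow> nat" where "psnd z = snd (prod_decode z)"

lemma pfst_encode [simp]: "pfst (prod_encode (a, b)) = a"
  and psnd_encode [simp]: "psnd (prod_encode (a, b)) = b"
  by (simp_all add: pfst_def psnd_def)

text \<open>A pair code is at least as large as both components, so each projection becomes a search
  with a bounded inner quantifier.\<close>

lemma prod_encode_bounded_ex:
  "(\<exists>b<Suc z. prod_encode (a, b) = z) \<longleftrightarrow> a = pfst z"
  "(\<exists>a<Suc z. prod_encode (a, b) = z) \<longleftrightarrow> b = psnd z"
proof -
  have z: "prod_encode (pfst z, psnd z) = z" by (simp add: pfst_def psnd_def)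
  then have "psnd z < Suc z" "pfst z < Suc z"
    using le_prod_encode_1[of "pfst z" "psnd z"] le_prod_encode_2[of "psnd z" "pfst z"] by auto
  with z show "(\<exists>b<Suc z. prod_encode (a, b) = z) \<longleftrightarrow> a = pfst z"
    "(\<exists>a<Suc z. prod_encode (a, b) = z) \<longleftrightarrow> b = psnd z"
    by (metis pfst_encode, metis psnd_encode)
qed

lemma computable_pfst: "computable B F \<Longrightarrow> computable B (\<lambda>e. pfst (F e))"
proof -
  assume F: "computable B F"
  have "computable B (\<lambda>e. LEAST a. \<exists>b<Suc (F e). prod_encode (a, b) = F e)"
    by (rule computable_Least, intro computable_ex computable_eq computable_prod_encode computable_Suc computable_var computable_shift computable_shift2 F)
      (simp add: prod_encode_bounded_ex)
  then show ?thesis by (simp only: prod_encode_bounded_ex) (simp add: Least_equality)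
qed

lemma computable_psnd: "computable B F \<Longrightarrow> computable B (\<lambda>e. psnd (F e))"
proof -
  assume F: "computable B F"
  have "computable B (\<lambda>e. LEAST b. \<exists>a<Suc (F e). prod_encode (a, b) = F e)"
    by (rule computable_Least, intro computable_ex computable_eq computable_prod_encode computable_Suc computable_var computable_shift computable_shift2 F)
      (simp add: prod_encode_bounded_ex)
  then show ?thesis by (simp only: prod_encode_bounded_ex) (simp add: Least_equality)
qed

section \<open>Turing reductions and joins\<close>

lemma turing_leI: "decidable B (\<lambda>e. e 0 \<in> A) \<Longrightarrow> A \<le>\<^sub>T B"
proof -
  assume "decidable B (\<lambda>e. e 0 \<in> A)"
  then obtain k p where p: "\<And>m e. m \<ge> k \<Longrightarrow> computes B p (map e [0..<m]) (of_bool (e 0 \<in> A))"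
    unfolding computable_def by blast
  \<comment> \<open>The single argument is repeated to reach the prefix length \<open>k\<close>;
    only entry 0 affects the result.\<close>
  have "computes B (PComp p (replicate k (PProj 0))) [n] (of_bool (n \<in> A))" for n
  proof (rule computes.comp)
    show "list_all2 (\<lambda>q y. computes B q [n] y) (replicate k (PProj 0)) (map (\<lambda>_. n) [0..<k])"
      using computes.proj[of 0 "[n]" B] by (simp add: list_all2_conv_all_nth)
    show "computes B p (map (\<lambda>_. n) [0..<k]) (of_bool (n \<in> A))"
      using p[of k "\<lambda>_. n"] by simp
  qed
  then show ?thesis unfolding turing_le_def by blast
qed

lemma computable_mem:
  assumes "A \<le>\<^sub>T B" "computable B F"
  shows "decidable B (\<lambda>e. F e \<in> A)"
proof -
  obtain p where "\<And>n. computes B p [n] (of_bool (n \<in> A))"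
    using assms(1) unfolding turing_le_def by blast
  from computable_unary[OF this assms(2)] show ?thesis .
qed

lemma mem_turing_join: "2 * n \<in> A \<oplus> C \<longleftrightarrow> n \<in> A" "2 * n + 1 \<in> A \<oplus> C \<longleftrightarrow> n \<in> C"
  unfolding turing_join_def by (auto simp: image_iff) presburger+

lemma turing_join_upper: "A \<le>\<^sub>T A \<oplus> C" "C \<le>\<^sub>T A \<oplus> C"
proof -
  have "decidable (A \<oplus> C) (\<lambda>e. 2 * e 0 \<in> A \<oplus> C)" "decidable (A \<oplus> C) (\<lambda>e. 2 * e 0 + 1 \<in> A \<oplus> C)"
    by (intro computable_mem turing_le_refl computable_plus computable_times computable_const computable_var)+
  then show "A \<le>\<^sub>T A \<oplus> C" "C \<le>\<^sub>T A \<oplus> C" unfolding mem_turing_join by (auto intro: turing_leI)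
qed

lemma turing_join_least:
  assumes AC: "A \<le>\<^sub>T B" "C \<le>\<^sub>T B"
  shows "A \<oplus> C \<le>\<^sub>T B"
proof -
  have *: "(\<not> odd n \<and> n div 2 ^ 1 \<in> A) \<or> (odd n \<and> n div 2 ^ 1 \<in> C) \<longleftrightarrow> n \<in> A \<oplus> C" for n
  proof (cases "even n")
    case True
    then obtain m where "n = 2 * m" by (rule evenE)
    then show ?thesis using mem_turing_join(1)[of m A C] by simp
  next
    case False
    then obtain m where "n = 2 * m + 1" by (rule oddE)
    then show ?thesis using mem_turing_join(2)[of m A C] by simp
  qed
  have "decidable B (\<lambda>e. (\<not> odd (e 0) \<and> e 0 div 2 ^ 1 \<in> A) \<or> (odd (e 0) \<and> e 0 div 2 ^ 1 \<in> C))"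
    by (intro computable_disj computable_conj computable_not computable_odd computable_mem AC computable_div_pow2 computable_var computable_const)
  then show ?thesis unfolding * by (rule turing_leI)
qed

text \<open>In binary, \<open>word_code w + 1\<close> is a leading 1 followed by the letters of \<open>w\<close>, last letter
  first; so letters and length are read off by shifting.\<close>

definition letter :: "bool list \<Rightarrow> nat \<Rightarrow> bool" where
  "letter w i \<longleftrightarrow> i < length w \<and> w ! i"

lemma Suc_word_code_Cons: "Suc (word_code (b # w)) = 2 * Suc (word_code w) + of_bool b"
  by simp

lemma length_word_code: "i < length w \<longleftrightarrow> 2 \<le> Suc (word_code w) div 2 ^ i"
proof (induction w arbitrary: i)
  case Nil
  have "Suc 0 div 2 ^ i \<le> Suc 0" by (rule div_le_dividend)
  then have "\<not> 2 \<le> Suc 0 div 2 ^ i" by linarith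
  then show ?case by simp
next
  case (Cons b w)
  show ?case
    unfolding Suc_word_code_Cons
  proof (cases i)
    case (Suc j)
    then show "i < length (b # w) \<longleftrightarrow> 2 \<le> (2 * Suc (word_code w) + of_bool b) div 2 ^ i"
      using Cons[of j] by (simp add: div_mult2_eq del: mult_Suc_right)
  qed simp
qed

lemma letter_word_code:
  "letter w i \<longleftrightarrow> 2 \<le> Suc (word_code w) div 2 ^ i \<and> odd (Suc (word_code w) div 2 ^ i)"
proof -
  have "w ! i \<longleftrightarrow> odd (Suc (word_code w) div 2 ^ i)" if "i < length w"
    using that
  proof (induction w arbitrary: i)
    case (Cons b w)
    show ?case
      unfolding Suc_word_code_Cons
    proof (cases i)
      case (Suc j)
      then show "(b # w) ! i \<longleftrightarrow> odd ((2 * Suc (word_code w) + of_bool b) div 2 ^ i)"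
        using Cons by (simp add: div_mult2_eq del: mult_Suc_right)
    qed simp
  qed simp
  then show ?thesis unfolding letter_def length_word_code by (auto simp: length_word_code)
qed

text \<open>Interpreted for two oracles: the set to be coded, which computes the limit word, and a
  set that computes \<open>f\<close> and one half, which decodes it.\<close>

locale word_oracle =
  fixes f :: "nat \<Rightarrow> bool list" and B :: "nat set"
  assumes graph_le: "word_fun_graph f \<le>\<^sub>T B"
begin

lemma computable_code: "computable B F \<Longrightarrow> computable B (\<lambda>e. word_code (f (F e)))"
proof -
  assume F: "computable B F"
  have *: "prod_encode (n, y) \<in> word_fun_graph f \<longleftrightarrow> y = word_code (f n)" for n y
    by (auto simp: word_fun_graph_def prod_encode_eq)
  have "computable B (\<lambda>e. LEAST y. prod_encode (F e, y) \<in> word_fun_graph f)"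
    by (rule computable_Least, intro computable_mem graph_le computable_prod_encode computable_var computable_shift F) (simp add: *)
  then show ?thesis unfolding * by (simp add: Least_equality)
qed

lemma computable_letter: "computable B F \<Longrightarrow> computable B G \<Longrightarrow> decidable B (\<lambda>e. letter (f (F e)) (G e))"
  unfolding letter_word_code
  by (intro computable_conj computable_le computable_odd computable_div_pow2 computable_Suc computable_code computable_const)

lemma computable_length: "computable B F \<Longrightarrow> computable B (\<lambda>e. length (f (F e)))"
proof -
  assume F: "computable B F"
  have *: "\<not> 2 \<le> Suc (word_code w) div 2 ^ i \<longleftrightarrow> length w \<le> i" for w i
    unfolding length_word_code[symmetric] by auto
  have "computable B (\<lambda>e. LEAST i. \<not> 2 \<le> Suc (word_code (f (F e))) div 2 ^ i)"
    by (rule computable_Least, intro computable_not computable_le computable_div_pow2 computable_Suc computable_const computable_var computable_code computable_shift F)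
      (unfold *, blast)
  moreover have "(LEAST i. length w \<le> i) = length w" for w :: "bool list"
    by (rule Least_equality) auto
  ultimately show ?thesis by (simp only: *)
qed

end

section \<open>Branching in non-periodic recurrent words\<close>

text \<open>\<open>K\<close> stands for the occurrences of a factor. If an occurrence determines
  everything to its right, two of them at distance \<open>b - a\<close> force this period to the
  right of every occurrence, and occurrences exist arbitrarily far to the left.\<close>

lemma periodic_if_deterministic:
  assumes below: "\<And>n. \<exists>c\<in>K. c \<le> n"
    and det: "\<And>a b i. a \<in> K \<Longrightarrow> b \<in> K \<Longrightarrow> 0 \<le> i \<Longrightarrow> \<xi> (a + i) = \<xi> (b + i)"
  shows "periodic \<xi>"
proof -
  obtain b where b: "b \<in> K" using below by blast
  obtain a where a: "a \<in> K" "a \<le> b - 1" using below by blast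
  have "\<xi> n = \<xi> (n + (b - a))" for n
  proof -
    obtain c where c: "c \<in> K" "c \<le> n" using below by blast
    have "\<xi> n = \<xi> (a + (n - c))" using det[OF c(1) a(1), of "n - c"] c(2) by simp
    also have "\<dots> = \<xi> (b + (n - c))" using det[OF a(1) b, of "n - c"] c(2) by simp
    also have "\<dots> = \<xi> (a + (n - c + (b - a)))" by (simp add: algebra_simps)
    also have "\<dots> = \<xi> (c + (n - c + (b - a)))" using det[OF a(1) c(1), of "n - c + (b - a)"] a(2) c(2) by simp
    finally show ?thesis by simp
  qed
  moreover have "b - a > 0" using a(2) by simp
  ultimately show ?thesis unfolding periodic_def by blast
qed

lemma occurs_iff: "seg \<xi> a (a + int (length w)) = w \<longleftrightarrow> (\<forall>m<length w. \<xi> (a + int m) = w ! m)"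
  unfolding seg_eq_iff by auto

lemma right_branching:
  assumes "recurrent \<xi>" "\<not> periodic \<xi>" "w \<in> factors \<xi>"
  shows "\<exists>a b i. 0 \<le> i \<and> seg \<xi> a (a + int (length w)) = w \<and> seg \<xi> b (b + int (length w)) = w \<and>
    \<xi> (a + i) \<noteq> \<xi> (b + i)"
proof (rule ccontr)
  assume contr: "\<not> ?thesis"
  have "\<exists>c\<in>{c. seg \<xi> c (c + int (length w)) = w}. c \<le> n" for n
  proof -
    obtain c where "c + int (length w) \<le> n" "seg \<xi> c (c + int (length w)) = w"
      using assms(1,3) unfolding recurrent_conv by blast
    then show ?thesis by (intro bexI[of _ c]) auto
  qed
  then have "periodic \<xi>" by (rule periodic_if_deterministic) (use contr in blast)
  with assms(2) show False ..
qed

lemma left_branching: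
  assumes "recurrent \<xi>" "\<not> periodic \<xi>" "w \<in> factors \<xi>"
  shows "\<exists>a b j. 0 \<le> j \<and> seg \<xi> a (a + int (length w)) = w \<and> seg \<xi> b (b + int (length w)) = w \<and>
    \<xi> (a - 1 - j) \<noteq> \<xi> (b - 1 - j)"
proof (rule ccontr)
  assume contr: "\<not> ?thesis"
  \<comment> \<open>In the reflected word \<open>\<xi> (- 1 - n)\<close>, the letters from
    \<open>- c\<close> rightwards are those of \<xi> from \<open>c - 1\<close> leftwards.\<close>
  define K where "K = uminus ` {c. seg \<xi> c (c + int (length w)) = w}"
  have "\<exists>c\<in>K. c \<le> n" for n
  proof -
    obtain c where "c \<ge> - n" "seg \<xi> c (c + int (length w)) = w"
      using assms(1,3) unfolding recurrent_conv by blast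
    then show ?thesis unfolding K_def by (intro bexI[of _ "- c"] imageI) auto
  qed
  moreover have "\<xi> (- 1 - (a + i)) = \<xi> (- 1 - (b + i))" if ab: "a \<in> K" "b \<in> K" "0 \<le> i" for a b i
  proof -
    obtain a' b' where "a = - a'" "b = - b'" "seg \<xi> a' (a' + int (length w)) = w"
        "seg \<xi> b' (b' + int (length w)) = w"
      using ab unfolding K_def by blast
    moreover from this have "\<xi> (a' - 1 - i) = \<xi> (b' - 1 - i)" using contr ab(3) by blast
    moreover have "- 1 - (- z + i) = z - 1 - i" for z :: int by simp
    ultimately show ?thesis by (simp only:)
  qed
  ultimately have "periodic (\<lambda>n. \<xi> (- 1 - n))" by (rule periodic_if_deterministic)
  then obtain p where p: "p > 0" "\<And>n. \<xi> (- 1 - n) = \<xi> (- 1 - (n + p))"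
    unfolding periodic_def by blast
  have "\<xi> n = \<xi> (n + p)" for n using p(2)[of "- 1 - (n + p)"] by (simp add: algebra_simps)
  with p(1) assms(2) show False unfolding periodic_def by blast
qed

text \<open>Lengthen \<open>w\<close> until it includes the letter at which its occurrences at
  \<open>a'\<close> and \<open>b\<close> differ. Two occurrences of the longer word that differ on
  the left cannot both agree with \<open>b\<close> there, and the one that disagrees still differs
  from \<open>b\<close> on the right.\<close>

lemma two_sided_branching:
  assumes \<xi>: "recurrent \<xi>" "\<not> periodic \<xi>" and w: "w \<in> factors \<xi>"
  shows "\<exists>a b i j. length w \<le> i \<and> seg \<xi> a (a + int (length w)) = w \<and>
    seg \<xi> b (b + int (length w)) = w \<and> \<xi> (a + int i) \<noteq> \<xi> (b + int i) \<and>
    \<xi> (a - 1 - int j) \<noteq> \<xi> (b - 1 - int j)"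
proof -
  obtain a' b i where ab: "0 \<le> i" "seg \<xi> a' (a' + int (length w)) = w"
      "seg \<xi> b (b + int (length w)) = w" "\<xi> (a' + i) \<noteq> \<xi> (b + i)"
    using right_branching[OF assms] by blast
  define n where "n = nat i"
  have n: "\<xi> (a' + int n) \<noteq> \<xi> (b + int n)" using ab(1,4) by (simp add: n_def)
  \<comment> \<open>Two occurrences of \<open>w\<close> agree within \<open>w\<close>, so the
    difference lies beyond its end.\<close>
  have le: "length w \<le> n" using ab(2,3) n unfolding occurs_iff by (metis not_le)
  define v where "v = seg \<xi> a' (a' + int (Suc n))"
  have lv: "length v = Suc n" by (simp add: v_def)
  obtain a1 a2 j where a12: "0 \<le> j" "seg \<xi> a1 (a1 + int (length v)) = v"
      "seg \<xi> a2 (a2 + int (length v)) = v" "\<xi> (a1 - 1 - j) \<noteq> \<xi> (a2 - 1 - j)"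
    using left_branching[OF \<xi>, of v] seg_in_factors unfolding v_def by blast
  then obtain a where a: "seg \<xi> a (a + int (length v)) = v" "\<xi> (a - 1 - j) \<noteq> \<xi> (b - 1 - j)"
    by metis
  have eq: "\<xi> (a + int m) = \<xi> (a' + int m)" if "m \<le> n" for m
  proof -
    have "\<xi> (a + int m) = v ! m" using a(1) that lv unfolding occurs_iff by auto
    then show ?thesis using that by (simp add: v_def nth_seg)
  qed
  have "seg \<xi> a (a + int (length w)) = w" using ab(2) eq le unfolding occurs_iff by simp
  moreover have "\<xi> (a + int n) \<noteq> \<xi> (b + int n)" using n eq by simp
  moreover have "\<xi> (a - 1 - int (nat j)) \<noteq> \<xi> (b - 1 - int (nat j))" using a(2) a12(1) by simp
  ultimately show ?thesis using le ab(3) by blast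
qed

section \<open>Coding a set into a word\<close>

definition occurs_at :: "bool list \<Rightarrow> bool list \<Rightarrow> nat \<Rightarrow> bool" where
  "occurs_at u w d \<longleftrightarrow> d + length u \<le> length w \<and> (\<forall>i<length u. letter w (d + i) = letter u i)"

lemma occurs_at_trans: "occurs_at u v d \<Longrightarrow> occurs_at v w d' \<Longrightarrow> occurs_at u w (d' + d)"
  unfolding occurs_at_def by (auto simp: add.assoc)

lemma letter_seg: "letter (seg \<xi> a b) m \<longleftrightarrow> a + int m < b \<and> \<xi> (a + int m)"
  by (auto simp: letter_def nth_seg)

lemma occurs_at_seg:
  assumes "seg \<xi> x (x + int (length u)) = u" "a \<le> x" "x + int (length u) \<le> b"
  shows "occurs_at u (seg \<xi> a b) (nat (x - a))"
  using assms unfolding occurs_at_def occurs_iff by (auto simp: letter_def nth_seg)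

text \<open>Nested pairs: every number codes an infinite sequence, so no length has to be stored or
  checked.\<close>

fun entry :: "nat \<Rightarrow> nat \<Rightarrow> nat" where
  "entry z 0 = pfst z"
| "entry z (Suc i) = entry (psnd z) i"

lemma computable_entry: "computable B F \<Longrightarrow> computable B (\<lambda>e. entry (F e) i)"
  by (induction i arbitrary: F) (simp_all add: entry.simps computable_pfst computable_psnd)

declare entry.simps [simp del]

text \<open>The bounds on \<open>p\<close> and \<open>q\<close> make both searches bounded, hence
  the relation decidable from \<open>f\<close>.\<close>

definition surrounds :: "(nat \<Rightarrow> bool list) \<Rightarrow> nat \<Rightarrow> nat \<Rightarrow> nat \<Rightarrow> nat \<Rightarrow> bool" where
  "surrounds f n k n' d \<longleftrightarrow> occurs_at (f n) (f n') d \<and>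
     (\<exists>p<Suc (length (f n')). d + length (f n) \<le> p \<and> occurs_at (f k) (f n') p) \<and>
     (\<exists>q<Suc d. q + length (f k) \<le> d \<and> occurs_at (f k) (f n') q)"

text \<open>\<open>t\<close> codes \<open>(n\<^sub>0, d\<^sub>0, n\<^sub>1, d\<^sub>1, i, j)\<close>: the words \<open>f n\<^sub>0\<close> and \<open>f n\<^sub>1\<close> extend \<open>f n\<close>, which they
  contain at \<open>d\<^sub>0\<close> resp. \<open>d\<^sub>1\<close>, and differ at distance \<open>i\<close> to the right of the start of \<open>f n\<close> and at
  distance \<open>j + 1\<close> to the left of it.\<close>

definition branch :: "(nat \<Rightarrow> bool list) \<Rightarrow> nat \<Rightarrow> nat \<Rightarrow> nat \<Rightarrow> bool" where
  "branch f n k t \<longleftrightarrow>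
     surrounds f n k (entry t 0) (entry t 1) \<and> surrounds f n k (entry t 2) (entry t 3) \<and>
     length (f n) \<le> entry t 4 \<and>
     entry t 1 + entry t 4 < length (f (entry t 0)) \<and> entry t 3 + entry t 4 < length (f (entry t 2)) \<and>
     \<not> (letter (f (entry t 0)) (entry t 1 + entry t 4) \<longleftrightarrow>
        letter (f (entry t 2)) (entry t 3 + entry t 4)) \<and>
     entry t 5 < entry t 1 \<and> entry t 5 < entry t 3 \<and>
     \<not> (letter (f (entry t 0)) (entry t 1 - 1 - entry t 5) \<longleftrightarrow>
        letter (f (entry t 2)) (entry t 3 - 1 - entry t 5))"

text \<open>The least code depends only on \<open>f\<close>, the stage and the index of the current
  word, so encoder and decoder make the same choice.\<close>

definition pick :: "(nat \<Rightarrow> bool list) \<Rightarrow> nat \<Rightarrow> nat \<Rightarrow> nat" where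
  "pick f k s = (LEAST t. branch f (pfst s) k t)"

text \<open>A state pairs the index of the current word with the position of the origin in it;
  extending on the left moves that position.\<close>

definition next_state :: "nat \<Rightarrow> nat \<Rightarrow> bool \<Rightarrow> nat" where
  "next_state s t b = (if b then prod_encode (entry t 2, psnd s + entry t 3)
     else prod_encode (entry t 0, psnd s + entry t 1))"

section \<open>Effectiveness of the search\<close>

context word_oracle begin

lemma computable_occurs_at: "computable B F \<Longrightarrow> computable B G \<Longrightarrow> computable B H \<Longrightarrow> decidable B (\<lambda>e. occurs_at (f (F e)) (f (G e)) (H e))"
  unfolding occurs_at_def
  by (intro computable_conj computable_le computable_plus computable_all computable_iff computable_letter computable_length computable_shift computable_var)

lemma computable_surrounds:
  "computable B F \<Longrightarrow> computable B G \<Longrightarrow> computable B H \<Longrightarrow> computable B L \<Longrightarrow> decidable B (\<lambda>e. surrounds f (F e) (G e) (H e) (L e))"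
  unfolding surrounds_def
  by (intro computable_conj computable_ex computable_occurs_at computable_le computable_plus computable_length computable_Suc computable_shift computable_var)

lemma computable_branch: "computable B F \<Longrightarrow> computable B G \<Longrightarrow> computable B H \<Longrightarrow> decidable B (\<lambda>e. branch f (F e) (G e) (H e))"
  unfolding branch_def
  by (intro computable_conj computable_not computable_iff computable_surrounds computable_letter computable_le computable_less computable_plus computable_minus computable_length
      computable_entry computable_const)

lemma computable_pick:
  assumes ex: "\<And>n k. \<exists>t. branch f n k t" and "computable B K" "computable B S"
  shows "computable B (\<lambda>e. pick f (K e) (S e))"
  unfolding pick_def
  by (rule computable_Least[OF _ ex]) (intro computable_branch computable_pfst computable_shift computable_var assms)

text \<open>\<open>\<beta>\<close> supplies the bit of a stage: a query to the coded set when
  encoding, a letter comparison when decoding.\<close>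

lemma computable_state:
  assumes ex: "\<And>n k. \<exists>t. branch f n k t"
    and st: "\<And>k. s (Suc k) = next_state (s k) (pick f k (s k)) (\<beta> k (s k) (pick f k (s k)))"
    and \<beta>: "\<And>K S T. computable B K \<Longrightarrow> computable B S \<Longrightarrow> computable B T \<Longrightarrow> decidable B (\<lambda>e. \<beta> (K e) (S e) (T e))"
    and F: "computable B F"
  shows "computable B (\<lambda>e. s (F e))"
proof -
  let ?u = "\<lambda>k r. next_state r (pick f k r) (\<beta> k r (pick f k r))"
  have "rec_nat (s 0) ?u m = s m" for m by (induction m) (simp_all add: st)
  moreover have "computable B (\<lambda>e. rec_nat (s 0) (\<lambda>k r. ?u k r) (F e))"
    unfolding next_state_def
    by (intro computable_rec computable_if \<beta> computable_pick ex computable_prod_encode computable_plus computable_entry computable_psnd computable_var computable_const F)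
  ultimately show ?thesis by simp
qed

end

section \<open>Construction of the limit word\<close>

locale coded_word =
  fixes \<xi> :: biword and f :: "nat \<Rightarrow> bool list" and A :: "nat set"
  assumes rec: "recurrent \<xi>" and aper: "\<not> periodic \<xi>" and range_f: "range f = factors \<xi>"
begin

text \<open>Recurrence yields \<open>f k\<close> on both sides of the given occurrence. A factor of
  \<xi> wide enough to contain these and to reach the distances \<open>i\<close> and
  \<open>j\<close> is a value of \<open>f\<close>.\<close>

lemma ex_surrounds:
  assumes x: "seg \<xi> x (x + int (length (f n))) = f n"
  shows "\<exists>n' d. surrounds f n k n' d \<and> j < d \<and> d + i < length (f n') \<and>
    (\<forall>m<length (f n'). letter (f n') m = \<xi> (x - int d + int m))"
proof -
  have "f k \<in> factors \<xi>" using range_f by blast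
  then obtain r l where r: "x + int (length (f n)) \<le> r" "seg \<xi> r (r + int (length (f k))) = f k"
    and l: "l + int (length (f k)) \<le> x" "seg \<xi> l (l + int (length (f k))) = f k"
    using rec unfolding recurrent_conv by meson
  define a where "a = min l (x - 1 - int j)"
  define b where "b = max (r + int (length (f k))) (x + int i + 1)"
  have "seg \<xi> a b \<in> range f" unfolding range_f by (rule seg_in_factors)
  then obtain n' where n': "f n' = seg \<xi> a b" by (metis rangeE)
  define d where "d = nat (x - a)"
  have ab: "a \<le> l" "a \<le> x - 1 - int j" "r + int (length (f k)) \<le> b" "x + int i + 1 \<le> b"
    by (auto simp: a_def b_def)
  have "occurs_at (f n) (f n') d" "occurs_at (f k) (f n') (nat (r - a))" "occurs_at (f k) (f n') (nat (l - a))"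
    unfolding n' d_def using ab r l x by (intro occurs_at_seg; simp)+
  moreover have "nat (r - a) < Suc (length (f n'))" "d + length (f n) \<le> nat (r - a)"
    "nat (l - a) < Suc d" "nat (l - a) + length (f k) \<le> d"
    unfolding n' d_def using ab r(1) l(1) by auto
  ultimately have "surrounds f n k n' d" unfolding surrounds_def by blast
  moreover have "j < d" "d + i < length (f n')" using ab by (auto simp: n' d_def)
  moreover have "letter (f n') m = \<xi> (x - int d + int m)" if "m < length (f n')" for m
    using that ab(2) by (auto simp: n' letter_seg d_def)
  ultimately show ?thesis by blast
qed

lemma ex_branch: "\<exists>t. branch f n k t"
proof -
  have "f n \<in> factors \<xi>" using range_f by blast
  then obtain a b i j where ij: "length (f n) \<le> i" "seg \<xi> a (a + int (length (f n))) = f n"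
    "seg \<xi> b (b + int (length (f n))) = f n" "\<xi> (a + int i) \<noteq> \<xi> (b + int i)"
    "\<xi> (a - 1 - int j) \<noteq> \<xi> (b - 1 - int j)"
    using two_sided_branching[OF rec aper] by blast
  obtain n0 d0 where 0: "surrounds f n k n0 d0" "j < d0" "d0 + i < length (f n0)"
    "\<And>m. m < length (f n0) \<Longrightarrow> letter (f n0) m = \<xi> (a - int d0 + int m)"
    using ex_surrounds[OF ij(2)] by blast
  obtain n1 d1 where 1: "surrounds f n k n1 d1" "j < d1" "d1 + i < length (f n1)"
    "\<And>m. m < length (f n1) \<Longrightarrow> letter (f n1) m = \<xi> (b - int d1 + int m)"
    using ex_surrounds[OF ij(3)] by blast
  have "letter (f n0) (d0 + i) = \<xi> (a + int i)" "letter (f n1) (d1 + i) = \<xi> (b + int i)"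
    using 0(3,4) 1(3,4) by simp_all
  moreover have "letter (f n0) (d0 - 1 - j) = \<xi> (a - 1 - int j)"
    "letter (f n1) (d1 - 1 - j) = \<xi> (b - 1 - int j)"
    using 0 1 by (simp_all add: of_nat_diff algebra_simps)
  \<comment> \<open>Only entries 0 to 5 are read; the last 0 merely closes the nesting.\<close>
  ultimately have "branch f n k (prod_encode (n0, prod_encode (d0, prod_encode (n1, prod_encode (d1,
      prod_encode (i, prod_encode (j, 0)))))))"
    unfolding branch_def using 0(1-3) 1(1-3) ij by (simp add: entry.simps numeral_eq_Suc)
  then show ?thesis ..
qed

primrec state :: "nat \<Rightarrow> nat" where
  "state 0 = prod_encode (0, 0)"
| "state (Suc k) = next_state (state k) (pick f k (state k)) (k \<in> A)"

definition word :: "nat \<Rightarrow> bool list" where "word k = f (pfst (state k))"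
definition centre :: "nat \<Rightarrow> nat" where "centre k = psnd (state k)"
definition witness :: "nat \<Rightarrow> nat" where "witness k = pick f k (state k)"

lemma branch_witness: "branch f (pfst (state k)) k (witness k)"
  unfolding witness_def pick_def by (rule LeastI_ex) (rule ex_branch)

lemma word_Suc: "word (Suc k) = (if k \<in> A then f (entry (witness k) 2) else f (entry (witness k) 0))"
  and centre_Suc: "centre (Suc k) = centre k + (if k \<in> A then entry (witness k) 3 else entry (witness k) 1)"
  by (simp_all add: word_def centre_def witness_def next_state_def)

lemma state_step:
  obtains d where "centre (Suc k) = centre k + d" "0 < d" "occurs_at (word k) (word (Suc k)) d"
    "d + length (word k) < length (word (Suc k))"
    "\<exists>p. d + length (word k) \<le> p \<and> occurs_at (f k) (word (Suc k)) p"
    "\<exists>q. q + length (f k) \<le> d \<and> occurs_at (f k) (word (Suc k)) q"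
proof -
  define d where "d = (if k \<in> A then entry (witness k) 3 else entry (witness k) 1)"
  have W: "word (Suc k) = f (if k \<in> A then entry (witness k) 2 else entry (witness k) 0)"
    by (simp add: word_Suc)
  note br = branch_witness[of k, unfolded branch_def, folded word_def]
  have sur: "surrounds f (pfst (state k)) k (if k \<in> A then entry (witness k) 2 else entry (witness k) 0) d"
    using br by (simp add: d_def)
  have "0 < d" "d + length (word k) < length (word (Suc k))"
    using br unfolding W d_def by (cases "k \<in> A"; simp)+
  moreover have "centre (Suc k) = centre k + d" by (simp add: centre_Suc d_def)
  moreover note sur[unfolded surrounds_def, folded W word_def]
  ultimately show thesis by (intro that[of d]) blast+
qed

text \<open>Each stage adds a letter at either end, so the words eventually cover every integer
  coordinate.\<close>

lemma centre_ge: "k \<le> centre k" and word_ge: "centre k + k \<le> length (word k)"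
proof (induction k)
  case 0
  show "0 \<le> centre 0" "centre 0 + 0 \<le> length (word 0)" by (simp_all add: centre_def)
next
  case (Suc k)
  show "Suc k \<le> centre (Suc k)" "centre (Suc k) + Suc k \<le> length (word (Suc k))"
    using Suc by (auto intro: state_step[of k])
qed

lemma occurs_at_word: "k \<le> l \<Longrightarrow> centre k \<le> centre l \<and> occurs_at (word k) (word l) (centre l - centre k)"
proof (induction l rule: dec_induct)
  case base
  show ?case by (simp add: occurs_at_def)
next
  case (step l)
  obtain d where "centre (Suc l) = centre l + d" "occurs_at (word l) (word (Suc l)) d"
    using state_step[of l] by blast
  moreover from this step.IH have "occurs_at (word k) (word (Suc l)) (d + (centre l - centre k))"
    using occurs_at_trans by blast
  ultimately show ?case using step.IH by (simp add: add.commute)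
qed

text \<open>By \<open>centre_ge\<close> and \<open>word_ge\<close> the word of stage
  \<open>Suc (nat \<bar>z\<bar>)\<close> covers \<open>z\<close>. Naming the stage explicitly makes
  both halves computable from the states.\<close>

definition limit :: biword where
  "limit z = letter (word (Suc (nat \<bar>z\<bar>))) (nat (z + int (centre (Suc (nat \<bar>z\<bar>)))))"

text \<open>Any stage that covers a coordinate shows the same letter there, because the earlier of
  two words sits in the later one with the origins aligned.\<close>

lemma limit_eq:
  assumes "m < length (word k)"
  shows "limit (int m - int (centre k)) = letter (word k) m"
proof -
  define z where "z = int m - int (centre k)"
  define l where "l = Suc (nat \<bar>z\<bar>)"
  define m' where "m' = nat (z + int (centre l))"
  have "\<bar>z\<bar> < int l" by (simp add: l_def)
  then have "0 \<le> z + int (centre l)" "z + int (centre l) < int (length (word l))"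
    using centre_ge[of l] word_ge[of l] by linarith+
  then have m': "int m' = z + int (centre l)" "m' < length (word l)" by (auto simp: m'_def)
  have "limit z = letter (word l) m'" by (simp add: limit_def l_def m'_def)
  also have "\<dots> = letter (word k) m"
  proof (cases "k \<le> l")
    case True
    then have "m' = centre l - centre k + m" using occurs_at_word[OF True] m'(1) z_def by linarith
    then show ?thesis using occurs_at_word[OF True] assms unfolding occurs_at_def by blast
  next
    case False
    then have le: "l \<le> k" by simp
    then have "m = centre k - centre l + m'" using occurs_at_word[OF le] m'(1) z_def by linarith
    then show ?thesis using occurs_at_word[OF le] m'(2) unfolding occurs_at_def by blast
  qed
  finally show ?thesis by (simp add: z_def)
qed

lemma limit_seg: "seg limit (- int (centre k)) (int (length (word k)) - int (centre k)) = word k"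
  unfolding seg_eq_iff
proof (intro conjI allI impI)
  fix i assume i: "i < nat (int (length (word k)) - int (centre k) - - int (centre k))"
  then have "word k ! i = letter (word k) i" by (simp add: letter_def)
  then show "word k ! i = limit (- int (centre k) + int i)"
    using limit_eq[of i k] i by simp
qed simp

lemma limit_occurs_at:
  assumes "occurs_at u (word k) p"
  shows "seg limit (int p - int (centre k)) (int p - int (centre k) + int (length u)) = u"
  unfolding occurs_iff
proof (intro allI impI)
  fix m assume m: "m < length u"
  then have "limit (int (p + m) - int (centre k)) = letter (word k) (p + m)"
    using assms by (intro limit_eq) (simp add: occurs_at_def)
  also have "\<dots> = letter u m" using assms m by (simp add: occurs_at_def)
  also have "\<dots> = u ! m" using m by (simp add: letter_def)
  finally show "limit (int p - int (centre k) + int m) = u ! m" by (simp add: algebra_simps)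
qed

section \<open>Factors and recurrence of the limit word\<close>

lemma factors_limit_subset: "factors limit \<subseteq> factors \<xi>"
proof
  fix w assume "w \<in> factors limit"
  then obtain a where a: "seg limit a (a + int (length w)) = w" by (auto simp: factors_conv)
  let ?b = "a + int (length w)"
  define k where "k = nat (\<bar>a\<bar> + \<bar>?b\<bar>)"
  have "int k = \<bar>a\<bar> + \<bar>?b\<bar>" by (simp add: k_def)
  then have "- int (centre k) \<le> a" "?b \<le> int (length (word k)) - int (centre k)"
    using centre_ge[of k] word_ge[of k] by linarith+
  then have "seg limit (- int (centre k)) a @ seg limit a ?b @
      seg limit ?b (int (length (word k)) - int (centre k)) = word k"
    by (simp add: seg_append limit_seg)
  moreover have "word k \<in> factors \<xi>" using range_f by (auto simp: word_def)
  ultimately show "w \<in> factors \<xi>" using a factors_append by metis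
qed

lemma occurs_both_sides:
  "\<exists>a\<ge>0. seg limit a (a + int (length (f k))) = f k"
  "\<exists>a. a + int (length (f k)) \<le> 0 \<and> seg limit a (a + int (length (f k))) = f k"
proof -
  obtain d p q where d: "centre (Suc k) = centre k + d"
    and p: "d + length (word k) \<le> p" "occurs_at (f k) (word (Suc k)) p"
    and q: "q + length (f k) \<le> d" "occurs_at (f k) (word (Suc k)) q"
    using state_step[of k] by metis
  show "\<exists>a\<ge>0. seg limit a (a + int (length (f k))) = f k"
    using limit_occurs_at[OF p(2)] p(1) d word_ge[of k]
    by (intro exI[of _ "int p - int (centre (Suc k))"]) auto
  show "\<exists>a. a + int (length (f k)) \<le> 0 \<and> seg limit a (a + int (length (f k))) = f k"
    using limit_occurs_at[OF q(2)] q(1) d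
    by (intro exI[of _ "int q - int (centre (Suc k))"]) auto
qed

text \<open>Each factor is only known to occur once on either side of the origin. Applying this to a
  factor of \<xi> with \<bar>i\<bar> further letters before or after \<open>w\<close> pushes
  \<open>w\<close> arbitrarily far out.\<close>

lemma occurs_far:
  assumes w: "w \<in> factors \<xi>"
  shows "\<exists>a\<ge>i. seg limit a (a + int (length w)) = w"
    and "\<exists>a. a + int (length w) \<le> i \<and> seg limit a (a + int (length w)) = w"
proof -
  obtain b where b: "seg \<xi> b (b + int (length w)) = w" using w by (auto simp: factors_conv)
  define N where "N = nat \<bar>i\<bar>"
  have shift: "seg limit (a + int N') (a + int N' + int (length w)) = w"
    if "seg limit a (a + int (length v)) = v" "v = seg \<xi> (b - int N') c" "b + int (length w) \<le> c"
    for a v c N'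
    unfolding occurs_iff
  proof (intro allI impI)
    fix m assume m: "m < length w"
    then have "N' + m < length v" using that by simp
    then have "limit (a + int (N' + m)) = v ! (N' + m)"
      using that(1) unfolding occurs_iff by blast
    also have "\<dots> = \<xi> (b + int m)" using m that by (simp add: nth_seg)
    also have "\<dots> = w ! m" using b m unfolding occurs_iff by simp
    finally show "limit (a + int N' + int m) = w ! m" by (simp add: add.assoc)
  qed
  have "seg \<xi> (b - int N) (b + int (length w)) \<in> range f" unfolding range_f by (rule seg_in_factors)
  then obtain k where k: "f k = seg \<xi> (b - int N) (b + int (length w))" by (metis rangeE)
  obtain a where "a \<ge> 0" "seg limit a (a + int (length (f k))) = f k"
    using occurs_both_sides(1) by blast
  then show "\<exists>a\<ge>i. seg limit a (a + int (length w)) = w"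
    using shift[OF _ k] by (intro exI[of _ "a + int N"]) (auto simp: N_def)
  have "seg \<xi> b (b + int (length w) + int N) \<in> range f" unfolding range_f by (rule seg_in_factors)
  then obtain k where k: "f k = seg \<xi> (b - int 0) (b + int (length w) + int N)" by (metis rangeE diff_zero of_nat_0)
  obtain a where a: "a + int (length (f k)) \<le> 0" "seg limit a (a + int (length (f k))) = f k"
    using occurs_both_sides(2) by blast
  have "length (f k) = length w + N" by (simp add: k nat_add_distrib)
  then show "\<exists>a. a + int (length w) \<le> i \<and> seg limit a (a + int (length w)) = w"
    using shift[OF a(2) k] a(1) by (intro exI[of _ a]) (auto simp: N_def)
qed

lemma factors_limit: "factors limit = factors \<xi>"
  using factors_limit_subset occurs_far(1) factors_conv by blast

lemma recurrent_limit: "recurrent limit"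
  unfolding recurrent_conv factors_limit using occurs_far by blast

lemma MTh_limit: "MTh limit = MTh \<xi>"
  using recurrent_limit rec factors_limit by (rule MTh_eq_of_factors_eq)

section \<open>Computing the halves and decoding from them\<close>

lemma right_half_limit: "n \<in> right_half limit \<longleftrightarrow> letter (word (Suc n)) (n + centre (Suc n))"
  by (simp add: right_half_def limit_def nat_add_distrib)

lemma left_half_limit: "n \<in> left_half limit \<longleftrightarrow> 0 < n \<and> letter (word (Suc n)) (centre (Suc n) - n)"
  using centre_ge[of "Suc n"] by (auto simp: left_half_def limit_def nat_diff_distrib' algebra_simps)

text \<open>The current word starts at coordinate \<open>- psnd s\<close>, so distance
  \<open>entry t 4\<close> from its start is coordinate \<open>entry t 4 - psnd s\<close>. The two
  candidates differ there; the limit agrees with the second exactly if the bit is set.\<close>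

definition decode_right :: "nat \<Rightarrow> nat \<Rightarrow> bool" where
  "decode_right s t \<longleftrightarrow> (entry t 4 - psnd s \<in> right_half limit \<longleftrightarrow>
     letter (f (entry t 2)) (entry t 3 + entry t 4))"

text \<open>The 1 accounts for counting leftwards from the letter just before the current
  word.\<close>

definition decode_left :: "nat \<Rightarrow> nat \<Rightarrow> bool" where
  "decode_left s t \<longleftrightarrow> (psnd s + 1 + entry t 5 \<in> left_half limit \<longleftrightarrow>
     letter (f (entry t 2)) (entry t 3 - 1 - entry t 5))"

lemma decode_right: "decode_right (state k) (witness k) \<longleftrightarrow> k \<in> A"
proof -
  define d where "d = (if k \<in> A then entry (witness k) 3 else entry (witness k) 1)"
  let ?i = "entry (witness k) 4"
  note br = branch_witness[of k, unfolded branch_def, folded word_def]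
  \<comment> \<open>The difference lies beyond the end of \<open>word k\<close>, which reaches past
    the origin; so its coordinate is non-negative and the natural subtraction is exact.\<close>
  have C: "centre k \<le> ?i" using br word_ge[of k] by linarith
  have "limit (int (d + ?i) - int (centre (Suc k))) = letter (word (Suc k)) (d + ?i)"
    using br by (intro limit_eq) (auto simp: word_Suc d_def)
  moreover have "int (d + ?i) - int (centre (Suc k)) = int (?i - centre k)"
    using C by (simp add: centre_Suc d_def)
  ultimately have "?i - centre k \<in> right_half limit \<longleftrightarrow> letter (word (Suc k)) (d + ?i)"
    by (simp add: right_half_def)
  then show ?thesis
    using br by (auto simp: decode_right_def centre_def[symmetric] word_Suc d_def)
qed

lemma decode_left: "decode_left (state k) (witness k) \<longleftrightarrow> k \<in> A"
proof -
  define d where "d = (if k \<in> A then entry (witness k) 3 else entry (witness k) 1)"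
  let ?j = "entry (witness k) 5"
  note br = branch_witness[of k, unfolded branch_def, folded word_def]
  have jd: "?j < d" using br by (auto simp: d_def)
  obtain d' where d': "centre (Suc k) = centre k + d'" "d' + length (word k) < length (word (Suc k))"
    using state_step[of k] by blast
  have "d' = d" using d'(1) by (simp add: centre_Suc d_def)
  have "limit (int (d - 1 - ?j) - int (centre (Suc k))) = letter (word (Suc k)) (d - 1 - ?j)"
    using d'(2) \<open>d' = d\<close> by (intro limit_eq) linarith
  moreover have "int (d - 1 - ?j) - int (centre (Suc k)) = - int (centre k + 1 + ?j)"
    using jd by (simp add: centre_Suc d_def of_nat_diff)
  ultimately have "centre k + 1 + ?j \<in> left_half limit \<longleftrightarrow> letter (word (Suc k)) (d - 1 - ?j)"
    by (simp add: left_half_def)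
  then show ?thesis
    using br by (auto simp: decode_left_def centre_def[symmetric] word_Suc d_def)
qed

lemma halves_le:
  assumes "word_fun_graph f \<le>\<^sub>T A"
  shows "right_half limit \<le>\<^sub>T A" "left_half limit \<le>\<^sub>T A"
proof -
  interpret word_oracle f A by unfold_locales (rule assms)
  have st: "computable A F \<Longrightarrow> computable A (\<lambda>e. state (F e))" for F
    by (rule computable_state[where \<beta> = "\<lambda>k s t. k \<in> A"]) (auto intro: ex_branch computable_mem turing_le_refl)
  show "right_half limit \<le>\<^sub>T A" "left_half limit \<le>\<^sub>T A"
    by (rule turing_leI, unfold right_half_limit left_half_limit word_def centre_def,
        intro computable_conj computable_less computable_letter computable_pfst computable_psnd computable_plus computable_minus st computable_Suc computable_var computable_const)+
qed

text \<open>The recursion for \<open>state\<close> asks one question about \<open>A\<close> per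
  stage. The decoded bit answers it from \<open>B\<close>, so the same states are retraced without
  \<open>A\<close>, and each stage then reveals its own bit.\<close>

lemma le_halves:
  assumes "word_fun_graph f \<le>\<^sub>T B"
  shows "right_half limit \<le>\<^sub>T B \<Longrightarrow> A \<le>\<^sub>T B" "left_half limit \<le>\<^sub>T B \<Longrightarrow> A \<le>\<^sub>T B"
proof -
  interpret word_oracle f B by unfold_locales (rule assms)
  have *: "A \<le>\<^sub>T B" if dec: "\<And>k. dec (state k) (witness k) \<longleftrightarrow> k \<in> A"
    and computable: "\<And>S T. computable B S \<Longrightarrow> computable B T \<Longrightarrow> decidable B (\<lambda>e. dec (S e) (T e))" for dec
  proof (rule turing_leI)
    have st: "computable B (\<lambda>e. state (e 0))"
      by (rule computable_state[where \<beta> = "\<lambda>k s t. dec s t"])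
        (auto intro: ex_branch computable computable_var simp: dec[unfolded witness_def])
    show "decidable B (\<lambda>e. e 0 \<in> A)"
      unfolding dec[symmetric] witness_def by (intro computable computable_pick ex_branch st computable_var)
  qed
  show "A \<le>\<^sub>T B" if "right_half limit \<le>\<^sub>T B"
    by (rule *[OF decode_right], unfold decode_right_def,
        intro computable_iff computable_mem that computable_letter computable_minus computable_plus computable_entry computable_psnd)
  show "A \<le>\<^sub>T B" if "left_half limit \<le>\<^sub>T B"
    by (rule *[OF decode_left], unfold decode_left_def,
        intro computable_iff computable_mem that computable_letter computable_minus computable_plus computable_entry computable_psnd computable_const)
qed

end

theorem theorem5p8:
  fixes \<xi> :: biword and f :: "nat \<Rightarrow> bool list" and a :: "nat set set"
  assumes "recurrent \<xi>"
    and "\<not> periodic \<xi>"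
    and "range f = factors \<xi>"
    and "a \<in> turing_degrees"
    and "degree_le (turing_degree (word_fun_graph f)) a"
  shows "\<exists>\<xi>\<^sub>A :: biword. MTh \<xi>\<^sub>A = MTh \<xi> \<and>
    left_half \<xi>\<^sub>A \<oplus> word_fun_graph f \<equiv>\<^sub>T right_half \<xi>\<^sub>A \<oplus> word_fun_graph f \<and>
    left_half \<xi>\<^sub>A \<oplus> word_fun_graph f \<in> a \<and>
    right_half \<xi>\<^sub>A \<oplus> word_fun_graph f \<in> a"
proof -
  obtain A where A: "a = turing_degree A"
    using assms(4) unfolding turing_degrees_def turing_degree_def by (rule quotientE)
  have f_le: "word_fun_graph f \<le>\<^sub>T A" using assms(5) unfolding A degree_le_turing_degree .
  interpret coded_word \<xi> f A by unfold_locales (fact assms)+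
  let ?L = "left_half limit \<oplus> word_fun_graph f" and ?R = "right_half limit \<oplus> word_fun_graph f"
  have "?L \<le>\<^sub>T A" "?R \<le>\<^sub>T A" using halves_le[OF f_le] f_le by (auto intro: turing_join_least)
  moreover have "A \<le>\<^sub>T ?L" "A \<le>\<^sub>T ?R"
    using le_halves turing_join_upper by blast+
  ultimately have "?L \<equiv>\<^sub>T ?R" "?L \<in> a" "?R \<in> a"
    unfolding A turing_degree_def turing_equiv_def turing_eq_def
    by (simp_all, blast intro: turing_le_trans)
  then show ?thesis using MTh_limit by blast
qed

end
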